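(* Let $0<x_c<x_d<1$, let $a\in L^\infty(0,1)$ be real-valued with $a|_{(x_c,x_d)}<0$ and $a|_{(0,x_c)\cup(x_d,1)}>0$, and let $a(0)>0$ and $a(1)>0$ be given real constants. Let $\varepsilon>0$. Then the function $\psi$ obtained from Steps 1--4 of the three-region domain decomposition algorithm (described in the context) belongs to $W^{2,\infty}(0,1)$ and is the unique solution in $W^{2,\infty}(0,1)$ of the boundary value problem $$\varepsilon^2\psi''(x)+a(x)\psi(x)=0,\quad x\in(0,1),$$ $$\varepsilon\psi'(0)+i\sqrt{a(0)}\,\psi(0)=0,\qquad \varepsilon\psi'(1)-i\sqrt{a(1)}\,\psi(1)=-2i\sqrt{a(1)}.$$
   Context: Convention: $a(0)$ and $a(1)$ are not point values of the $L^\infty$-function $a$; they are given real constants (the constant values of the coefficient in the left lead $x\le 0$ and the right lead $x\ge 1$, respectively). Differential equations are understood to hold almost everywhere for $W^{2,\infty}$ functions, where $W^{2,\infty}\subset C^1$ up to the boundary. All functions are complex-valued. Three-region domain decomposition algorithm: Step 1. $\zeta\in W^{2,\infty}(0,x_c)$ is the unique solution of the initial value problem $\varepsilon^2\zeta''+a\zeta=0$ on $(0,x_c)$, $\zeta(0)=1$, $\varepsilon\zeta'(0)=-i\sqrt{a(0)}$. Step 2. $\chi\in W^{2,\infty}(x_c,x_d)$ is the unique solution of the boundary value problem $\varepsilon^2\chi''+a\chi=0$ on $(x_c,x_d)$, $\zeta'(x_c)\chi(x_c)-\zeta(x_c)\chi'(x_c)=0$, $\varepsilon\chi'(x_d)=1$.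 Step 3. $\varphi\in W^{2,\infty}(x_d,1)$ is the unique solution of the initial value problem $\varepsilon^2\varphi''+a\varphi=0$ on $(x_d,1)$, $\varphi(x_d)=\chi(x_d)$, $\varphi'(x_d)=\chi'(x_d)$. Step 4. Set $\psi:=\beta\zeta$ on $(0,x_c)$, $\psi:=\alpha\chi$ on $(x_c,x_d)$, $\psi:=\alpha\varphi$ on $(x_d,1)$, where $\alpha,\beta\in\mathbb{C}\setminus\{0\}$ are the scaling parameters determined by $$\alpha\,[\varepsilon\varphi'(1)-i\sqrt{a(1)}\,\varphi(1)]=-2i\sqrt{a(1)},\qquad \beta\,\zeta(x_c)=\alpha\,\chi(x_c).$$ *)

theory Defs
  imports "HOL-Analysis.Analysis"
begin

definition L_inf :: "real \<Rightarrow> real \<Rightarrow> (real \<Rightarrow> 'a::real_normed_vector) set" where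
  "L_inf c d = {u. u \<in> borel_measurable (lebesgue_on {c<..<d}) \<and>
     (\<exists>B. AE x in lebesgue_on {c<..<d}. norm (u x) \<le> B)}"

definition test_functions :: "real \<Rightarrow> real \<Rightarrow> (real \<Rightarrow> real) set" where
  "test_functions c d = {\<phi>. (\<forall>n x. (deriv ^^ n) \<phi> field_differentiable (at x)) \<and>
     compact (closure {x. \<phi> x \<noteq> 0}) \<and> closure {x. \<phi> x \<noteq> 0} \<subseteq> {c<..<d}}"

text \<open>Meaningful only if \<open>u\<close> and \<open>w\<close> are locally integrable (a non-integrable integrand would
  count as integral \<open>0\<close>); below both are always in \<open>L_inf c d\<close>.\<close>
definition weak_deriv ::
  "nat \<Rightarrow> real \<Rightarrow> real \<Rightarrow> (real \<Rightarrow> complex) \<Rightarrow> (real \<Rightarrow> complex) \<Rightarrow> bool" where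
  "weak_deriv k c d u w \<longleftrightarrow> (\<forall>\<phi>\<in>test_functions c d.
     (LINT x|lebesgue_on {c<..<d}. (deriv ^^ k) \<phi> x *\<^sub>R u x) =
     (-1) ^ k * (LINT x|lebesgue_on {c<..<d}. \<phi> x *\<^sub>R w x))"

text \<open>Derivative relative to \<open>[c,d]\<close>, hence one-sided at \<open>c\<close> and \<open>d\<close>.\<close>
definition deriv_on :: "real \<Rightarrow> real \<Rightarrow> (real \<Rightarrow> complex) \<Rightarrow> real \<Rightarrow> complex" where
  "deriv_on c d u x = vector_derivative u (at x within {c..d})"

text \<open>The Sobolev space \<open>W\<^sup>2\<^sup>,\<^sup>\<infinity>(c,d)\<close>. As \<open>W\<^sup>2\<^sup>,\<^sup>\<infinity>(c,d) \<subseteq> C\<^sup>1([c,d])\<close>, an element is represented by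
  its \<open>C\<^sup>1\<close> representative (the first two conditions), so that boundary values of \<open>u\<close> and \<open>u'\<close>
  make sense; values of \<open>u\<close> outside \<open>[c,d]\<close> are irrelevant.\<close>
definition W2_inf :: "real \<Rightarrow> real \<Rightarrow> (real \<Rightarrow> complex) set" where
  "W2_inf c d = {u.
     (\<forall>x\<in>{c..d}. u differentiable (at x within {c..d})) \<and>
     continuous_on {c..d} (deriv_on c d u) \<and>
     u \<in> L_inf c d \<and>
     (\<forall>k\<in>{1,2}. \<exists>w\<in>L_inf c d. weak_deriv k c d u w)}"

text \<open>The equation \<open>\<epsilon>\<^sup>2u'' + au = 0\<close> a.e. on \<open>(c,d)\<close>, with \<open>u''\<close> the weak second derivative.\<close>
definition schroedinger ::
  "real \<Rightarrow> (real \<Rightarrow> real) \<Rightarrow> real \<Rightarrow> real \<Rightarrow> (real \<Rightarrow> complex) \<Rightarrow> bool" where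
  "schroedinger \<epsilon> a c d u \<longleftrightarrow> (\<exists>w\<in>L_inf c d. weak_deriv 2 c d u w \<and>
     (AE x in lebesgue_on {c<..<d}. complex_of_real (\<epsilon>^2) * w x + complex_of_real (a x) * u x = 0))"

definition unique_in_W2_inf ::
  "real \<Rightarrow> real \<Rightarrow> ((real \<Rightarrow> complex) \<Rightarrow> bool) \<Rightarrow> (real \<Rightarrow> complex) \<Rightarrow> bool" where
  "unique_in_W2_inf c d P u \<longleftrightarrow> u \<in> W2_inf c d \<and> P u \<and>
     (\<forall>v\<in>W2_inf c d. P v \<longrightarrow> (\<forall>x\<in>{c..d}. v x = u x))"

text \<open>\<open>a0\<close> and \<open>a1\<close> are the lead constants \<open>a(0)\<close> and \<open>a(1)\<close>, unrelated to the values of the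
  function \<open>a\<close> at these points.\<close>
definition step1 ::
  "real \<Rightarrow> (real \<Rightarrow> real) \<Rightarrow> real \<Rightarrow> real \<Rightarrow> (real \<Rightarrow> complex) \<Rightarrow> bool" where
  "step1 \<epsilon> a a0 xc \<zeta> \<longleftrightarrow> unique_in_W2_inf 0 xc (\<lambda>z. schroedinger \<epsilon> a 0 xc z \<and>
     z 0 = 1 \<and> complex_of_real \<epsilon> * deriv_on 0 xc z 0 = - \<i> * complex_of_real (sqrt a0)) \<zeta>"

definition step2 ::
  "real \<Rightarrow> (real \<Rightarrow> real) \<Rightarrow> real \<Rightarrow> real \<Rightarrow> (real \<Rightarrow> complex) \<Rightarrow> (real \<Rightarrow> complex) \<Rightarrow> bool" where
  "step2 \<epsilon> a xc xd \<zeta> chi \<longleftrightarrow> unique_in_W2_inf xc xd (\<lambda>z. schroedinger \<epsilon> a xc xd z \<and>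
     deriv_on 0 xc \<zeta> xc * z xc - \<zeta> xc * deriv_on xc xd z xc = 0 \<and>
     complex_of_real \<epsilon> * deriv_on xc xd z xd = 1) chi"

definition step3 ::
  "real \<Rightarrow> (real \<Rightarrow> real) \<Rightarrow> real \<Rightarrow> real \<Rightarrow> (real \<Rightarrow> complex) \<Rightarrow> (real \<Rightarrow> complex) \<Rightarrow> bool" where
  "step3 \<epsilon> a xc xd chi \<phi> \<longleftrightarrow> unique_in_W2_inf xd 1 (\<lambda>z. schroedinger \<epsilon> a xd 1 z \<and>
     z xd = chi xd \<and> deriv_on xd 1 z xd = deriv_on xc xd chi xd) \<phi>"

definition scaling_eqs ::
  "real \<Rightarrow> real \<Rightarrow> real \<Rightarrow> real \<Rightarrow> (real \<Rightarrow> complex) \<Rightarrow> (real \<Rightarrow> complex) \<Rightarrow> (real \<Rightarrow> complex) \<Rightarrow>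
   complex \<Rightarrow> complex \<Rightarrow> bool" where
  "scaling_eqs \<epsilon> a1 xc xd \<zeta> chi \<phi> \<alpha> \<beta> \<longleftrightarrow>
     \<alpha> * (complex_of_real \<epsilon> * deriv_on xd 1 \<phi> 1 - \<i> * complex_of_real (sqrt a1) * \<phi> 1)
       = - 2 * \<i> * complex_of_real (sqrt a1) \<and>
     \<beta> * \<zeta> xc = \<alpha> * chi xc"

definition step4 ::
  "real \<Rightarrow> real \<Rightarrow> real \<Rightarrow> real \<Rightarrow> (real \<Rightarrow> complex) \<Rightarrow> (real \<Rightarrow> complex) \<Rightarrow> (real \<Rightarrow> complex) \<Rightarrow>
   complex \<Rightarrow> complex \<Rightarrow> bool" where
  "step4 \<epsilon> a1 xc xd \<zeta> chi \<phi> \<alpha> \<beta> \<longleftrightarrow> \<alpha> \<noteq> 0 \<and> \<beta> \<noteq> 0 \<and> scaling_eqs \<epsilon> a1 xc xd \<zeta> chi \<phi> \<alpha> \<beta> \<and>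
     (\<forall>\<alpha>' \<beta>'. scaling_eqs \<epsilon> a1 xc xd \<zeta> chi \<phi> \<alpha>' \<beta>' \<longrightarrow> \<alpha>' = \<alpha> \<and> \<beta>' = \<beta>)"

text \<open>The values of the three scaled pieces at \<open>x\<^sub>c\<close> and \<open>x\<^sub>d\<close> agree by
  the second scaling equation and the initial value of \<open>\<phi>\<close>, so it does not matter to which
  piece an interface point is assigned.\<close>
definition three_region_output ::
  "real \<Rightarrow> (real \<Rightarrow> real) \<Rightarrow> real \<Rightarrow> real \<Rightarrow> real \<Rightarrow> real \<Rightarrow> (real \<Rightarrow> complex) \<Rightarrow> bool" where
  "three_region_output \<epsilon> a a0 a1 xc xd \<psi> \<longleftrightarrow> (\<exists>\<zeta> chi \<phi> \<alpha> \<beta>.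
     step1 \<epsilon> a a0 xc \<zeta> \<and> step2 \<epsilon> a xc xd \<zeta> chi \<and> step3 \<epsilon> a xc xd chi \<phi> \<and>
     step4 \<epsilon> a1 xc xd \<zeta> chi \<phi> \<alpha> \<beta> \<and>
     \<psi> = (\<lambda>x. if x \<le> xc then \<beta> * \<zeta> x else if x \<le> xd then \<alpha> * chi x else \<alpha> * \<phi> x))"

definition schroedinger_bvp ::
  "real \<Rightarrow> (real \<Rightarrow> real) \<Rightarrow> real \<Rightarrow> real \<Rightarrow> (real \<Rightarrow> complex) \<Rightarrow> bool" where
  "schroedinger_bvp \<epsilon> a a0 a1 u \<longleftrightarrow> schroedinger \<epsilon> a 0 1 u \<and>
     complex_of_real \<epsilon> * deriv_on 0 1 u 0 + \<i> * complex_of_real (sqrt a0) * u 0 = 0 \<and>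
     complex_of_real \<epsilon> * deriv_on 0 1 u 1 - \<i> * complex_of_real (sqrt a1) * u 1
       = - 2 * \<i> * complex_of_real (sqrt a1)"

end

theory Submission
  imports Defs
begin

text \<open>
  Everything is read off from one function \<open>Z\<close>: the solution on the whole interval \<open>[0,1]\<close> of the
  initial value problem \<open>Z'' = q Z\<close>, \<open>Z(0) = 1\<close>, \<open>\<epsilon> Z'(0) = - \<i> \<surd>a(0)\<close>, with \<open>q = - a / \<epsilon>\<^sup>2\<close>.
  A Cauchy problem has only one solution, so a solution on a subinterval is a multiple of \<open>Z\<close> as
  soon as its data at the left end are: each boundary condition of the algorithm forces
  \<open>\<zeta> = Z\<close>, \<open>\<chi> = \<mu> Z\<close> and \<open>\<phi> = \<mu> Z\<close>, and the
  left boundary condition of the full problem forces every solution to be a multiple \<open>k Z\<close>. No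
  gluing at the interfaces is needed, since the pieces are restrictions of one global solution.

  What remains is that the constants exist. The probability current \<open>Im (cnj Z \<cdot> Z')\<close> is constant
  because \<open>a\<close> is real, and it equals \<open>- \<surd>a(0) / \<epsilon> < 0\<close> at \<open>0\<close>. Hence
  neither \<open>Z\<close> nor \<open>Z'\<close> vanishes anywhere (this gives \<open>\<mu>\<close> and the ratio of the scalings), and
  \<open>\<epsilon> Z'(1) - \<i> \<surd>a(1) Z(1) \<noteq> 0\<close>, because equality would make the current at \<open>1\<close> nonnegative. So the
  right boundary condition determines \<open>k\<close>, and the two scaling equations yield the same \<open>k\<close>.

  The analytic work is to pass from the weak formulation to the integral form \<open>solves\<close> of the
  equation (\<open>schroedinger_imp_solves\<close>, \<open>solves_imp_schroedinger\<close>). The two tools are a product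
  rule for indefinite integrals of bounded measurable functions (\<open>primitive_mult\<close>) and the lemma
  of du Bois-Reymond, whose test functions are built from \<open>exp (- 1 / x)\<close>. In integral form the
  Cauchy problem is a Volterra equation, solved by its Neumann series (\<open>solves_exists\<close>,
  \<open>solves_unique\<close>), and the current is conserved by the product rule.
\<close>

section \<open>Bounded measurable functions and their primitives\<close>

lemma L_inf_bound_off_negligible:
  assumes "f \<in> L_inf c d"
  obtains B N where "0 \<le> B" "negligible N" "\<And>x. x \<in> {c..d} - N \<Longrightarrow> norm (f x) \<le> B"
proof -
  obtain B where "AE x in lebesgue_on {c<..<d}. norm (f x) \<le> B"
    using assms by (auto simp: L_inf_def)
  then have "AE x in lebesgue. x \<in> {c<..<d} \<longrightarrow> norm (f x) \<le> B"
    by (subst (asm) AE_restrict_space_iff) auto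
  then obtain N where N: "negligible N" "{x. \<not> (x \<in> {c<..<d} \<longrightarrow> norm (f x) \<le> B)} \<subseteq> N"
    by (auto simp: eventually_ae_filter_negligible)
  show ?thesis
  proof (rule that[of "max 0 B" "N \<union> {c, d}"])
    show "negligible (N \<union> {c, d})" by (intro negligible_Un N(1) negligible_finite) auto
    fix x assume x: "x \<in> {c..d} - (N \<union> {c, d})"
    then have "x \<in> {c<..<d}" "x \<notin> N" by auto
    with N(2) show "norm (f x) \<le> max 0 B" by auto
  qed simp
qed

lemma L_inf_integrable:
  fixes f :: "real \<Rightarrow> complex"
  assumes "f \<in> L_inf c d"
  shows "integrable (lebesgue_on {c<..<d}) f"
proof -
  interpret finite_measure "lebesgue_on {c<..<d}"
    by (rule finite_measure_lebesgue_on) simp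
  show ?thesis
    using assms integrable_const_bound[of f] by (auto simp: L_inf_def)
qed

lemma L_inf_integrable_on:
  fixes f :: "real \<Rightarrow> complex"
  assumes "f \<in> L_inf c d" and "c \<le> x" and "y \<le> d"
  shows "f integrable_on {x..y}"
proof -
  have "f integrable_on {c<..<d}"
    by (rule integrable_on_lebesgue_on[OF L_inf_integrable[OF assms(1)]]) simp
  then have "f integrable_on {c..d}" by (simp add: integrable_on_Icc_iff_Ioo)
  then show ?thesis by (rule integrable_on_subinterval) (use assms in auto)
qed

lemma L_inf_lebesgue_integral:
  fixes f :: "real \<Rightarrow> complex"
  assumes "f \<in> L_inf c d"
  shows "(LINT x|lebesgue_on {c<..<d}. f x) = integral {c..d} f"
  using lebesgue_integral_eq_integral[OF L_inf_integrable[OF assms]]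
  by (simp add: integral_open_interval_real)

lemma L_inf_continuous:
  fixes f :: "real \<Rightarrow> complex"
  assumes "continuous_on {c..d} f"
  shows "f \<in> L_inf c d"
proof -
  have "continuous_on {c<..<d} f" by (rule continuous_on_subset[OF assms]) auto
  then have "f \<in> borel_measurable (lebesgue_on {c<..<d})"
    by (rule continuous_imp_measurable_on_sets_lebesgue) simp
  moreover have "bounded (f ` {c..d})"
    using assms by (intro compact_imp_bounded compact_continuous_image) auto
  then obtain B where "\<forall>x\<in>{c..d}. norm (f x) \<le> B" by (auto simp: bounded_iff)
  then have "AE x in lebesgue_on {c<..<d}. norm (f x) \<le> B" by (intro AE_I2) auto
  ultimately show ?thesis by (auto simp: L_inf_def)
qed

lemma L_inf_add:
  fixes f g :: "real \<Rightarrow> complex"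
  assumes "f \<in> L_inf c d" and "g \<in> L_inf c d"
  shows "(\<lambda>x. f x + g x) \<in> L_inf c d"
proof -
  obtain A B where "AE x in lebesgue_on {c<..<d}. norm (f x) \<le> A"
    and "AE x in lebesgue_on {c<..<d}. norm (g x) \<le> B" using assms by (auto simp: L_inf_def)
  then have "AE x in lebesgue_on {c<..<d}. norm (f x + g x) \<le> A + B"
    by eventually_elim (rule norm_add_rule_thm)
  with assms show ?thesis by (auto simp: L_inf_def)
qed

lemma L_inf_mult:
  fixes f g :: "real \<Rightarrow> complex"
  assumes "f \<in> L_inf c d" and "g \<in> L_inf c d"
  shows "(\<lambda>x. f x * g x) \<in> L_inf c d"
proof -
  obtain A B where "AE x in lebesgue_on {c<..<d}. norm (f x) \<le> A"
    and "AE x in lebesgue_on {c<..<d}. norm (g x) \<le> B" using assms by (auto simp: L_inf_def)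
  then have "AE x in lebesgue_on {c<..<d}. norm (f x * g x) \<le> A * B"
    by eventually_elim (auto simp: norm_mult intro!: mult_mono order_trans[OF norm_ge_zero])
  with assms show ?thesis by (auto simp: L_inf_def)
qed

lemma L_inf_mult_integrable_on:
  fixes f g :: "real \<Rightarrow> complex"
  assumes "f \<in> L_inf c d" and "g \<in> L_inf c d"
  shows "(\<lambda>x. f x * g x) integrable_on {c..d}"
  by (rule L_inf_integrable_on[OF L_inf_mult[OF assms]]) auto

lemma L_inf_cmult:
  fixes f :: "real \<Rightarrow> complex"
  assumes "f \<in> L_inf c d"
  shows "(\<lambda>x. k * f x) \<in> L_inf c d"
  using L_inf_mult[OF L_inf_continuous[of c d "\<lambda>_. k"] assms] by auto

lemma L_inf_of_real:
  assumes "f \<in> L_inf c d"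
  shows "(\<lambda>x. complex_of_real (f x)) \<in> L_inf c d"
  using assms by (auto simp: L_inf_def)

lemma L_inf_subset:
  assumes f: "f \<in> L_inf c d" and sub: "c \<le> c'" "d' \<le> d"
  shows "f \<in> L_inf c' d'"
proof -
  have sub': "{c'<..<d'} \<subseteq> {c<..<d}" using sub by auto
  have "f \<in> borel_measurable (lebesgue_on {c'<..<d'})"
    using f measurable_restrict_mono[OF _ sub'] by (auto simp: L_inf_def)
  moreover obtain B where "AE x in lebesgue_on {c<..<d}. norm (f x) \<le> B"
    using f by (auto simp: L_inf_def)
  then have "AE x in lebesgue_on {c'<..<d'}. norm (f x) \<le> B"
    using sub' by (auto simp: AE_restrict_space_iff elim!: eventually_mono)
  ultimately show ?thesis by (auto simp: L_inf_def)
qed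

lemma L_inf_cnj:
  assumes "f \<in> L_inf c d"
  shows "(\<lambda>x. cnj (f x)) \<in> L_inf c d"
proof -
  have "cnj \<in> borel_measurable borel"
    by (intro borel_measurable_continuous_onI continuous_intros)
  then have "(\<lambda>x. cnj (f x)) \<in> borel_measurable (lebesgue_on {c<..<d})"
    using assms by (auto simp: L_inf_def intro: measurable_compose)
  with assms show ?thesis by (auto simp: L_inf_def)
qed

lemma has_integral_bound_off_negligible:
  fixes f :: "real \<Rightarrow> complex"
  assumes "(f has_integral I) {x..y}" and "negligible N" and "x \<le> y" and "0 \<le> B"
    and "\<And>t. t \<in> {x..y} - N \<Longrightarrow> norm (f t) \<le> B"
  shows "norm I \<le> B * (y - x)"
proof -
  let ?g = "\<lambda>t. if t \<in> N then 0 else f t"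
  have "(?g has_integral I) {x..y}"
    by (rule has_integral_spike[OF assms(2) _ assms(1)]) auto
  from has_integral_bound_real[OF assms(4) finite.emptyI this] show ?thesis using assms by auto
qed

text \<open>These are the Lipschitz functions together with an a.e. derivative. Only values on \<open>[c,d]\<close> matter.\<close>

definition primitive :: "real \<Rightarrow> real \<Rightarrow> (real \<Rightarrow> complex) \<Rightarrow> (real \<Rightarrow> complex) \<Rightarrow> bool" where
  "primitive c d F f \<longleftrightarrow> f \<in> L_inf c d \<and> (\<forall>x\<in>{c..d}. (f has_integral (F x - F c)) {c..x})"

lemma primitive_has_integral:
  assumes "primitive c d F f" and "c \<le> x" "x \<le> y" "y \<le> d"
  shows "(f has_integral (F y - F x)) {x..y}"
proof -
  have f: "f \<in> L_inf c d" and x: "(f has_integral (F x - F c)) {c..x}"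
    and y: "(f has_integral (F y - F c)) {c..y}"
    using assms by (auto simp: primitive_def)
  have i: "f integrable_on {x..y}" by (rule L_inf_integrable_on[OF f]) (use assms in auto)
  have "integral {c..x} f + integral {x..y} f = integral {c..y} f"
    using y assms by (intro Henstock_Kurzweil_Integration.integral_combine) auto
  then have "integral {x..y} f = F y - F x"
    using x y by (simp add: integral_unique algebra_simps)
  with i show ?thesis by (simp add: has_integral_iff)
qed

lemma primitive_subset:
  assumes "primitive c d F f" and "c \<le> c'" "d' \<le> d"
  shows "primitive c' d' F f"
  unfolding primitive_def
proof (intro conjI ballI)
  show "f \<in> L_inf c' d'"
    by (rule L_inf_subset[of f c d]) (use assms in \<open>auto simp: primitive_def\<close>)
  fix x assume "x \<in> {c'..d'}"
  then show "(f has_integral (F x - F c')) {c'..x}"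
    using assms by (intro primitive_has_integral[OF assms(1)]) auto
qed

lemma primitive_cong:
  assumes "primitive c d F f" and "\<And>x. x \<in> {c..d} \<Longrightarrow> G x = F x"
  shows "primitive c d G f"
  using assms by (auto simp: primitive_def)

lemma primitive_cong_AE:
  assumes "primitive c d F f" and "g \<in> L_inf c d"
    and "AE x in lebesgue_on {c<..<d}. g x = f x"
  shows "primitive c d F g"
proof -
  have "AE x in lebesgue. x \<in> {c<..<d} \<longrightarrow> g x = f x"
    using assms(3) by (subst (asm) AE_restrict_space_iff) auto
  then obtain N where N: "negligible N" "{x. \<not> (x \<in> {c<..<d} \<longrightarrow> g x = f x)} \<subseteq> N"
    by (auto simp: eventually_ae_filter_negligible)
  have neg: "negligible (N \<union> {c, d})" by (intro negligible_Un N(1) negligible_finite) auto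
  have "(g has_integral (F x - F c)) {c..x}" if "x \<in> {c..d}" for x
  proof (rule has_integral_spike[OF neg])
    show "(f has_integral (F x - F c)) {c..x}" using assms(1) that by (simp add: primitive_def)
    fix y assume "y \<in> {c..x} - (N \<union> {c, d})"
    then have "y \<in> {c<..<d}" "y \<notin> N" using that by auto
    with N(2) show "g y = f y" by blast
  qed
  with assms(2) show ?thesis by (simp add: primitive_def)
qed

lemma primitive_integral:
  assumes "f \<in> L_inf c d"
  shows "primitive c d (\<lambda>x. k + integral {c..x} f) f"
  unfolding primitive_def
proof (intro conjI ballI)
  fix x assume "x \<in> {c..d}"
  then have "f integrable_on {c..x}" by (intro L_inf_integrable_on[OF assms]) auto
  then show "(f has_integral (k + integral {c..x} f - (k + integral {c..c} f))) {c..x}"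
    by (simp add: has_integral_iff)
qed fact

lemma primitive_add:
  assumes "primitive c d F f" "primitive c d G g"
  shows "primitive c d (\<lambda>x. F x + G x) (\<lambda>x. f x + g x)"
  unfolding primitive_def
proof (intro conjI ballI)
  show "(\<lambda>x. f x + g x) \<in> L_inf c d" using assms by (intro L_inf_add) (auto simp: primitive_def)
  fix x assume "x \<in> {c..d}"
  then have "((\<lambda>x. f x + g x) has_integral ((F x - F c) + (G x - G c))) {c..x}"
    using assms by (intro has_integral_add) (auto simp: primitive_def)
  then show "((\<lambda>x. f x + g x) has_integral (F x + G x - (F c + G c))) {c..x}"
    by (simp add: algebra_simps)
qed

lemma primitive_cmult:
  assumes "primitive c d F f"
  shows "primitive c d (\<lambda>x. k * F x) (\<lambda>x. k * f x)"
  unfolding primitive_def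
proof (intro conjI ballI)
  show "(\<lambda>x. k * f x) \<in> L_inf c d" using assms by (intro L_inf_cmult) (auto simp: primitive_def)
  fix x assume "x \<in> {c..d}"
  then have "((\<lambda>x. k * f x) has_integral (k * (F x - F c))) {c..x}"
    using assms by (intro has_integral_mult_right) (auto simp: primitive_def)
  then show "((\<lambda>x. k * f x) has_integral (k * F x - k * F c)) {c..x}"
    by (simp add: algebra_simps)
qed

lemma primitive_cnj:
  assumes "primitive c d F f"
  shows "primitive c d (\<lambda>x. cnj (F x)) (\<lambda>x. cnj (f x))"
  unfolding primitive_def
proof (intro conjI ballI)
  show "(\<lambda>x. cnj (f x)) \<in> L_inf c d" using assms by (intro L_inf_cnj) (auto simp: primitive_def)
  fix x assume "x \<in> {c..d}"
  then have "(f has_integral (F x - F c)) {c..x}" using assms by (auto simp: primitive_def)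
  from has_integral_linear[OF this bounded_linear_cnj]
  show "((\<lambda>x. cnj (f x)) has_integral (cnj (F x) - cnj (F c))) {c..x}"
    by (simp add: o_def)
qed

lemma primitive_lipschitz:
  assumes "primitive c d F f"
  obtains B where "0 \<le> B" "\<And>x y. \<lbrakk>c \<le> x; x \<le> y; y \<le> d\<rbrakk> \<Longrightarrow> norm (F y - F x) \<le> B * (y - x)"
proof -
  obtain B N where B: "0 \<le> B" "negligible N" "\<And>x. x \<in> {c..d} - N \<Longrightarrow> norm (f x) \<le> B"
    using assms L_inf_bound_off_negligible unfolding primitive_def by blast
  show ?thesis
  proof (rule that[OF B(1)])
    fix x y assume "c \<le> x" "x \<le> y" "y \<le> d"
    then show "norm (F y - F x) \<le> B * (y - x)"
      using B by (intro has_integral_bound_off_negligible[OF primitive_has_integral[OF assms] B(2)]) auto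
  qed
qed

lemma primitive_continuous_on:
  assumes "primitive c d F f"
  shows "continuous_on {c..d} F"
proof -
  obtain B where B: "0 \<le> B" "\<And>x y. \<lbrakk>c \<le> x; x \<le> y; y \<le> d\<rbrakk> \<Longrightarrow> norm (F y - F x) \<le> B * (y - x)"
    using primitive_lipschitz[OF assms] by blast
  have "B-lipschitz_on {c..d} F"
  proof (rule lipschitz_onI)
    fix x y assume "x \<in> {c..d}" "y \<in> {c..d}"
    then show "dist (F x) (F y) \<le> B * dist x y"
      using B(2)[of x y] B(2)[of y x]
      by (cases "x \<le> y") (auto simp: dist_norm norm_minus_commute)
  qed fact
  then show ?thesis by (rule lipschitz_on_continuous_on)
qed

lemma primitive_L_inf:
  assumes "primitive c d F f"
  shows "F \<in> L_inf c d" and "f \<in> L_inf c d"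
  using assms L_inf_continuous[OF primitive_continuous_on[OF assms]] by (auto simp: primitive_def)

lemma primitive_has_vector_derivative:
  assumes "primitive c d F f" and "continuous_on {c..d} f" and "x \<in> {c..d}"
  shows "(F has_vector_derivative f x) (at x within {c..d})"
proof -
  have "((\<lambda>x. F c + integral {c..x} f) has_vector_derivative f x) (at x within {c..d})"
    using integral_has_vector_derivative[OF assms(2,3)] by (auto intro!: derivative_eq_intros)
  moreover have "F y = F c + integral {c..y} f" if "y \<in> {c..d}" for y
    using assms(1) that by (auto simp: primitive_def dest!: bspec[of _ _ y] integral_unique)
  ultimately show ?thesis
    by (rule has_vector_derivative_transform[OF assms(3), rotated])
qed

lemma primitive_of_vector_derivative:
  assumes "\<And>x. x \<in> {c..d} \<Longrightarrow> (F has_vector_derivative f x) (at x within {c..d})"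
    and "continuous_on {c..d} f"
  shows "primitive c d F f"
  unfolding primitive_def
proof (intro conjI ballI)
  show "f \<in> L_inf c d" using assms(2) by (rule L_inf_continuous)
  fix x assume x: "x \<in> {c..d}"
  show "(f has_integral (F x - F c)) {c..x}"
  proof (rule fundamental_theorem_of_calculus)
    fix y assume "y \<in> {c..x}"
    then show "(F has_vector_derivative f y) (at y within {c..x})"
      using x by (intro has_vector_derivative_within_subset[OF assms(1)]) auto
  qed (use x in auto)
qed

text \<open>A quadratic bound makes the derivative zero at every point, so no theorem on differentiation
  almost everywhere is involved.\<close>

lemma quadratic_increment_imp_constant:
  fixes H :: "real \<Rightarrow> complex"
  assumes "\<And>x y. \<lbrakk>c \<le> x; x \<le> y; y \<le> d\<rbrakk> \<Longrightarrow> norm (H y - H x) \<le> K * (y - x)^2"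
    and "x \<in> {c..d}"
  shows "H x = H c"
proof -
  have bound: "norm (H y - H x) \<le> norm (y - x) * (\<bar>K\<bar> * norm (y - x))"
    if "x \<in> {c..d}" "y \<in> {c..d}" for x y
  proof -
    have "K * (y - x)^2 \<le> \<bar>K\<bar> * (y - x)^2" by (intro mult_right_mono) auto
    then show ?thesis using assms(1)[of x y] assms(1)[of y x] that
      by (cases "x \<le> y") (force simp: norm_minus_commute power2_eq_square abs_if algebra_simps)+
  qed
  have "(H has_vector_derivative 0) (at x within {c..d})" if x: "x \<in> {c..d}" for x
  proof -
    have lim: "((\<lambda>y. \<bar>K\<bar> * norm (y - x)) \<longlongrightarrow> \<bar>K\<bar> * norm (x - x)) (at x within {c..d})"
      by (intro tendsto_intros)
    have "((\<lambda>y. (H y - H x) /\<^sub>R norm (y - x)) \<longlongrightarrow> 0) (at x within {c..d})"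
    proof (rule Lim_null_comparison[OF _ lim[simplified]])
      show "\<forall>\<^sub>F y in at x within {c..d}. norm ((H y - H x) /\<^sub>R norm (y - x)) \<le> \<bar>K\<bar> * \<bar>y - x\<bar>"
        unfolding eventually_at_filter
        by (rule always_eventually) (use bound x in \<open>auto simp: divide_simps mult.commute\<close>)
    qed
    then show ?thesis
      by (simp add: has_vector_derivative_def has_derivative_within bounded_linear_zero divide_inverse_commute
          flip: inverse_eq_divide)
  qed
  then obtain k where "\<And>y. y \<in> {c..d} \<Longrightarrow> H y = k"
    using has_vector_derivative_zero_constant[OF convex_real_interval(5), of c d H] by blast
  then show ?thesis using assms(2) by simp
qed

text \<open>The primitive \<open>F\<close> need not be differentiable at a given point, so the classical product
  rule does not apply. Instead, the defect \<open>H = F G - \<integral> (f G + F g)\<close> is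
  constant: its increment over \<open>[x,y]\<close> is the integral of \<open>f (G y - G t) + (F x - F t) g\<close>, and as
  \<open>F\<close> and \<open>G\<close> are Lipschitz this is quadratically small in \<open>y - x\<close>.\<close>

lemma primitive_mult:
  assumes Ff: "primitive c d F f" and Gg: "primitive c d G g"
  shows "primitive c d (\<lambda>x. F x * G x) (\<lambda>x. f x * G x + F x * g x)"
proof -
  let ?h = "\<lambda>x. f x * G x + F x * g x"
  let ?H = "\<lambda>x. F x * G x - integral {c..x} ?h"
  note f = primitive_L_inf(2)[OF Ff] and g = primitive_L_inf(2)[OF Gg]
  have h: "?h \<in> L_inf c d"
    by (intro L_inf_add L_inf_mult f g primitive_L_inf(1)[OF Ff] primitive_L_inf(1)[OF Gg])
  obtain A M where A: "0 \<le> A" "negligible M" "\<And>x. x \<in> {c..d} - M \<Longrightarrow> norm (f x) \<le> A"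
    using L_inf_bound_off_negligible[OF f] by blast
  obtain B N where B: "0 \<le> B" "negligible N" "\<And>x. x \<in> {c..d} - N \<Longrightarrow> norm (g x) \<le> B"
    using L_inf_bound_off_negligible[OF g] by blast
  obtain LF where LF: "0 \<le> LF" "\<And>x y. \<lbrakk>c \<le> x; x \<le> y; y \<le> d\<rbrakk> \<Longrightarrow> norm (F y - F x) \<le> LF * (y - x)"
    using primitive_lipschitz[OF Ff] by blast
  obtain LG where LG: "0 \<le> LG" "\<And>x y. \<lbrakk>c \<le> x; x \<le> y; y \<le> d\<rbrakk> \<Longrightarrow> norm (G y - G x) \<le> LG * (y - x)"
    using primitive_lipschitz[OF Gg] by blast
  have "norm (?H y - ?H x) \<le> (A * LG + LF * B) * (y - x)^2" if xy: "c \<le> x" "x \<le> y" "y \<le> d" for x y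
  proof -
    have "((\<lambda>t. f t * G y + F x * g t - ?h t) has_integral
        ((F y - F x) * G y + F x * (G y - G x) - integral {x..y} ?h)) {x..y}"
      using xy by (intro has_integral_diff has_integral_add has_integral_mult_left
          has_integral_mult_right primitive_has_integral[OF Ff] primitive_has_integral[OF Gg]
          integrable_integral L_inf_integrable_on[OF h])
    moreover have "integral {c..y} ?h = integral {c..x} ?h + integral {x..y} ?h"
      using xy by (intro Henstock_Kurzweil_Integration.integral_combine[symmetric]
          L_inf_integrable_on[OF h]) auto
    ultimately have "((\<lambda>t. f t * (G y - G t) + (F x - F t) * g t) has_integral (?H y - ?H x)) {x..y}"
      by (simp add: algebra_simps)
    then have "norm (?H y - ?H x) \<le> (A * (LG * (y - x)) + (LF * (y - x)) * B) * (y - x)"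
    proof (rule has_integral_bound_off_negligible)
      show "negligible (M \<union> N)" using A B by auto
      fix t assume t: "t \<in> {x..y} - (M \<union> N)"
      have "norm (f t) \<le> A" "norm (g t) \<le> B" using t xy A B by auto
      moreover have "norm (G y - G t) \<le> LG * (y - x)"
        by (rule order_trans[OF LG(2)]) (use t xy LG in \<open>auto intro: mult_left_mono\<close>)
      moreover have "norm (F t - F x) \<le> LF * (y - x)"
        by (rule order_trans[OF LF(2)]) (use t xy LF in \<open>auto intro: mult_left_mono\<close>)
      ultimately show "norm (f t * (G y - G t) + (F x - F t) * g t)
          \<le> A * (LG * (y - x)) + (LF * (y - x)) * B"
        using A(1) B(1) LF(1) LG(1) xy
        by (intro norm_triangle_le add_mono) (auto simp: norm_mult norm_minus_commute intro!: mult_mono)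
    qed (use xy A B LF LG in auto)
    then show ?thesis by (simp add: algebra_simps power2_eq_square)
  qed
  then have H: "?H x = ?H c" if "x \<in> {c..d}" for x
    using quadratic_increment_imp_constant[of c d ?H] that by blast
  show ?thesis
  proof (rule primitive_cong[OF primitive_integral[OF h]])
    fix x assume "x \<in> {c..d}"
    from H[OF this] show "F x * G x = F c * G c + integral {c..x} ?h"
      by (simp only: diff_eq_eq) simp
  qed
qed

section \<open>Smooth bumps and the lemma of du Bois-Reymond\<close>

text \<open>For \<open>p = 1\<close> this is the smooth function \<open>exp (- 1 / x)\<close> that vanishes to infinite order at \<open>0\<close>.
  The polynomial factor makes the family closed under differentiation.\<close>

definition flat :: "real poly \<Rightarrow> real \<Rightarrow> real" where
  "flat p x = (if x > 0 then poly p (inverse x) * exp (- inverse x) else 0)"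

lemma poly_times_exp_neg_tendsto_0:
  "((\<lambda>y. poly p y * exp (- y)) \<longlongrightarrow> (0::real)) at_top"
proof -
  have "((\<lambda>y. \<Sum>i\<le>degree p. coeff p i * (y ^ i / exp y)) \<longlongrightarrow> (\<Sum>i\<le>degree p. coeff p i * 0)) at_top"
    by (intro tendsto_sum tendsto_mult tendsto_const tendsto_power_div_exp_0)
  then show ?thesis
    by (simp add: poly_altdef exp_minus divide_inverse sum_distrib_right mult.assoc)
qed

text \<open>At \<open>0\<close> the difference quotient is \<open>y p(y) exp (- y)\<close> with \<open>y = 1 / x\<close>, which tends to \<open>0\<close>.\<close>

lemma flat_has_derivative:
  "(flat p has_field_derivative flat ([:0, 0, 1:] * (p - pderiv p)) x) (at x)"
proof (cases x "0::real" rule: linorder_cases)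
  case less
  have "((\<lambda>x. 0) has_field_derivative 0) (at x)" by simp
  then have "(flat p has_field_derivative 0) (at x)"
    by (rule has_field_derivative_transform_within_open[of _ _ _ "{..<0}"])
       (use less in \<open>auto simp: flat_def\<close>)
  then show ?thesis using less by (simp add: flat_def)
next
  case greater
  have "((\<lambda>x. poly p (inverse x) * exp (- inverse x)) has_field_derivative
      flat ([:0, 0, 1:] * (p - pderiv p)) x) (at x)"
    using greater
    by (auto intro!: derivative_eq_intros DERIV_chain'[OF _ poly_DERIV]
        simp: flat_def algebra_simps)
  then show ?thesis
    by (rule has_field_derivative_transform_within_open[of _ _ _ "{0<..}"])
       (use greater in \<open>auto simp: flat_def\<close>)
next
  case equal
  have "((\<lambda>y. poly ([:0, 1:] * p) (inverse y) * exp (- inverse y)) \<longlongrightarrow> 0) (at_right 0)"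
    by (rule filterlim_compose[OF poly_times_exp_neg_tendsto_0 filterlim_inverse_at_top_right])
  then have "((\<lambda>y. flat p y / y) \<longlongrightarrow> 0) (at_right 0)"
    by (rule tendsto_cong[THEN iffD1, rotated])
       (auto simp: eventually_at_filter flat_def divide_inverse intro!: always_eventually)
  moreover have "((\<lambda>y. flat p y / y) \<longlongrightarrow> 0) (at_left 0)"
    by (rule tendsto_cong[THEN iffD1, OF _ tendsto_const])
       (auto simp: eventually_at_filter flat_def intro!: always_eventually)
  ultimately have "((\<lambda>y. flat p y / y) \<longlongrightarrow> 0) (at 0)"
    by (simp add: filterlim_split_at)
  then show ?thesis
    using equal by (simp add: has_field_derivative_iff flat_def)
qed

text \<open>The algebra generated by the two one-sided families. It is closed under differentiation, which
  gives smoothness of all members at once, without any formula for higher derivatives.\<close>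

inductive_set bump_algebra :: "(real \<Rightarrow> real) set" where
  left: "(\<lambda>x. flat p (x - l)) \<in> bump_algebra"
| right: "(\<lambda>x. flat p (r - x)) \<in> bump_algebra"
| cmult: "f \<in> bump_algebra \<Longrightarrow> (\<lambda>x. k * f x) \<in> bump_algebra"
| add: "f \<in> bump_algebra \<Longrightarrow> g \<in> bump_algebra \<Longrightarrow> (\<lambda>x. f x + g x) \<in> bump_algebra"
| mult: "f \<in> bump_algebra \<Longrightarrow> g \<in> bump_algebra \<Longrightarrow> (\<lambda>x. f x * g x) \<in> bump_algebra"

lemma bump_algebra_closed_under_derivative:
  assumes "f \<in> bump_algebra"
  shows "\<exists>f'\<in>bump_algebra. \<forall>x. (f has_field_derivative f' x) (at x)"
  using assms
proof induction
  case (left p l)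
  have "((\<lambda>x. flat p (x - l)) has_field_derivative flat ([:0, 0, 1:] * (p - pderiv p)) (x - l)) (at x)" for x
    by (rule DERIV_cong[OF DERIV_chain'[OF _ flat_has_derivative]]) (auto intro!: derivative_eq_intros)
  then show ?case by (intro bexI[OF _ bump_algebra.left]) blast
next
  case (right p r)
  have "((\<lambda>x. flat p (r - x)) has_field_derivative - 1 * flat ([:0, 0, 1:] * (p - pderiv p)) (r - x)) (at x)" for x
    by (rule DERIV_cong[OF DERIV_chain'[OF _ flat_has_derivative]]) (auto intro!: derivative_eq_intros)
  then show ?case by (intro bexI[OF _ bump_algebra.cmult[OF bump_algebra.right]]) blast
next
  case (cmult f k)
  then obtain f' where "f' \<in> bump_algebra" "\<And>x. (f has_field_derivative f' x) (at x)" by blast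
  then show ?case by (intro bexI[OF _ bump_algebra.cmult]) (auto intro!: DERIV_cmult)
next
  case (add f g)
  then obtain f' g' where *: "f' \<in> bump_algebra" "\<And>x. (f has_field_derivative f' x) (at x)"
    "g' \<in> bump_algebra" "\<And>x. (g has_field_derivative g' x) (at x)" by blast
  then show ?case by (intro bexI[OF _ bump_algebra.add[OF *(1,3)]]) (auto intro!: DERIV_add)
next
  case (mult f g)
  then obtain f' g' where *: "f' \<in> bump_algebra" "\<And>x. (f has_field_derivative f' x) (at x)"
    "g' \<in> bump_algebra" "\<And>x. (g has_field_derivative g' x) (at x)" by blast
  show ?case
  proof (intro bexI allI)
    show "(\<lambda>x. f' x * g x + f x * g' x) \<in> bump_algebra"
      using * mult.hyps by (intro bump_algebra.intros)
    show "((\<lambda>x. f x * g x) has_field_derivative f' x * g x + f x * g' x) (at x)" for x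
      using DERIV_mult[OF *(2) *(4)] by (simp add: algebra_simps)
  qed
qed

lemma bump_algebra_continuous_on: "f \<in> bump_algebra \<Longrightarrow> continuous_on A f"
  using bump_algebra_closed_under_derivative
  by (metis DERIV_isCont continuous_at_imp_continuous_on)

lemma smooth_of_derivative_closed:
  fixes f :: "real \<Rightarrow> real"
  assumes "\<And>g. g \<in> S \<Longrightarrow> \<exists>g'\<in>S. \<forall>x. (g has_field_derivative g' x) (at x)" and "f \<in> S"
  shows "(deriv ^^ n) f field_differentiable (at x)"
proof -
  have "(deriv ^^ n) f \<in> S"
  proof (induction n)
    case (Suc n)
    from assms(1)[OF Suc] obtain g' where g': "g' \<in> S"
      "\<And>x. ((deriv ^^ n) f has_field_derivative g' x) (at x)" by blast
    then have "(deriv ^^ Suc n) f = g'" by (auto intro!: DERIV_imp_deriv)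
    with g' show ?case by simp
  qed (use assms in simp)
  from assms(1)[OF this] show ?thesis by (auto simp: field_differentiable_def)
qed

lemma unit_mass_bump_exists:
  assumes "l < r"
  obtains b where "b \<in> bump_algebra" "\<And>x. 0 \<le> b x" "\<And>x. x \<notin> {l<..<r} \<Longrightarrow> b x = 0"
    "(b has_integral 1) {l..r}"
proof -
  let ?b = "\<lambda>x. flat 1 (x - l) * flat 1 (r - x)"
  have b: "?b \<in> bump_algebra" by (intro bump_algebra.intros)
  have nonneg: "0 \<le> ?b x" for x by (simp add: flat_def)
  have int: "(?b has_integral integral {l..r} ?b) {l..r}"
    using bump_algebra_continuous_on[OF b] by (intro integrable_integral integrable_continuous_real)
  have "integral {l..r} ?b \<noteq> 0"
  proof
    assume "integral {l..r} ?b = 0"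
    with int have "(?b has_integral 0) (cbox l r)" by simp
    then have "?b ((l + r) / 2) = 0"
      using bump_algebra_continuous_on[OF b] nonneg assms
      by (intro has_integral_0_cbox_imp_0[of l r ?b]) auto
    then show False using assms by (simp add: flat_def)
  qed
  moreover have "0 \<le> integral {l..r} ?b" using nonneg by (intro integral_nonneg has_integral_integrable[OF int]) auto
  ultimately have pos: "0 < integral {l..r} ?b" by simp
  show ?thesis
  proof (rule that)
    show "(\<lambda>x. inverse (integral {l..r} ?b) * ?b x) \<in> bump_algebra" by (intro bump_algebra.intros)
    show "((\<lambda>x. inverse (integral {l..r} ?b) * ?b x) has_integral 1) {l..r}"
      using has_integral_mult_right[OF int, of "inverse (integral {l..r} ?b)"] pos by simp
    show "0 \<le> inverse (integral {l..r} ?b) * ?b x" for x using pos nonneg by simp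
    show "inverse (integral {l..r} ?b) * ?b x = 0" if "x \<notin> {l<..<r}" for x
      using that by (auto simp: flat_def)
  qed
qed

text \<open>A bump function has a compactly supported primitive precisely when its total mass is zero.\<close>

lemma test_function_with_derivative:
  assumes \<beta>: "\<beta> \<in> bump_algebra" and lr: "c < l" "l < r" "r < d"
    and zero: "\<And>x. x \<notin> {l<..<r} \<Longrightarrow> \<beta> x = 0" and int: "(\<beta> has_integral 0) {l..r}"
  obtains \<phi> where "\<phi> \<in> test_functions c d" "deriv \<phi> = \<beta>"
proof -
  \<comment> \<open>Starting the integral to the left of the support makes \<open>l\<close> an interior point of the
    domain of integration.\<close>
  define \<phi> where "\<phi> x = integral {l - 1..x} \<beta>" for x
  note integrable = integrable_continuous_real[OF bump_algebra_continuous_on[OF \<beta>]]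
  have left: "\<phi> x = 0" if "x \<le> l" for x
    unfolding \<phi>_def using that zero integral_cong[of "{l - 1..x}" \<beta> "\<lambda>_. 0"] by simp
  have right: "\<phi> x = 0" if "r \<le> x" for x
  proof -
    have "integral {l - 1..x} \<beta> = integral {l - 1..l} \<beta> + integral {l..r} \<beta> + integral {r..x} \<beta>"
      using lr that by (simp add: Henstock_Kurzweil_Integration.integral_combine integrable)
    moreover have "integral {r..x} \<beta> = integral {r..x} (\<lambda>_. 0)"
      using zero by (intro integral_cong) auto
    ultimately show ?thesis using left[of l] int by (simp add: \<phi>_def integral_unique)
  qed
  have deriv: "(\<phi> has_field_derivative \<beta> x) (at x)" for x
  proof (cases "x < l")
    case True
    have "((\<lambda>x. 0) has_field_derivative 0) (at x)" by simp
    then have "(\<phi> has_field_derivative 0) (at x)"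
      by (rule has_field_derivative_transform_within_open[of _ _ _ "{..<l}"])
         (use True left in auto)
    then show ?thesis using True zero by simp
  next
    case False
    have "(\<phi> has_vector_derivative \<beta> x) (at x within {l - 1..x + 1})"
      unfolding \<phi>_def using False
      by (intro integral_has_vector_derivative bump_algebra_continuous_on \<beta>) auto
    moreover have "at x within {l - 1..x + 1} = at x"
      using False by (intro at_within_interior) auto
    ultimately show ?thesis by (simp add: has_real_derivative_iff_has_vector_derivative)
  qed
  have "(deriv ^^ n) \<phi> field_differentiable (at x)" for n x
  proof (rule smooth_of_derivative_closed[of "insert \<phi> bump_algebra"])
    fix g assume "g \<in> insert \<phi> bump_algebra"
    then show "\<exists>g'\<in>insert \<phi> bump_algebra. \<forall>x. (g has_field_derivative g' x) (at x)"
      using deriv \<beta> bump_algebra_closed_under_derivative by blast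
  qed simp
  moreover have "{x. \<phi> x \<noteq> 0} \<subseteq> {l..r}"
    using left right by (metis (mono_tags, lifting) atLeastAtMost_iff linear mem_Collect_eq subsetI)
  then have sub: "closure {x. \<phi> x \<noteq> 0} \<subseteq> {l..r}" by (rule closure_minimal) simp
  then have "compact (closure {x. \<phi> x \<noteq> 0})"
    by (metis closed_closure compact_Icc compact_Int_closed inf.absorb_iff2)
  moreover have "closure {x. \<phi> x \<noteq> 0} \<subseteq> {c<..<d}" using sub lr by auto
  ultimately have "\<phi> \<in> test_functions c d" by (auto simp: test_functions_def)
  moreover have "deriv \<phi> = \<beta>" using deriv by (auto intro: DERIV_imp_deriv)
  ultimately show ?thesis by (rule that)
qed

text \<open>Averages of a continuous function against unit-mass bumps concentrating at \<open>s\<close> tend to its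
  value at \<open>s\<close>.\<close>

lemma bump_average_approximates:
  fixes g :: "real \<Rightarrow> complex"
  assumes g: "continuous_on {c..d} g" and s: "s \<in> {c<..<d}" and e: "0 < e"
  obtains b l r where "b \<in> bump_algebra" "c < l" "l < r" "r < d"
    "\<And>x. x \<notin> {l<..<r} \<Longrightarrow> b x = 0" "(b has_integral 1) {c..d}"
    "norm (integral {c..d} (\<lambda>x. of_real (b x) * g x) - g s) \<le> e"
proof -
  obtain \<delta> where \<delta>: "0 < \<delta>" "\<And>x. x \<in> {c..d} \<Longrightarrow> dist x s < \<delta> \<Longrightarrow> dist (g x) (g s) < e"
    using g[unfolded continuous_on_iff, rule_format, of s e] s e by auto
  define h where "h = min (\<delta> / 2) (min ((s - c) / 2) ((d - s) / 2))"
  have h: "0 < h" "h < \<delta>" "c < s - h" "s + h < d" using s \<delta>(1) by (auto simp: h_def min_def field_simps)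
  obtain b where b: "b \<in> bump_algebra" "\<And>x. 0 \<le> b x" "\<And>x. x \<notin> {s - h<..<s + h} \<Longrightarrow> b x = 0"
    "(b has_integral 1) {s - h..s + h}"
    using unit_mass_bump_exists[of "s - h" "s + h"] h by auto
  have 1: "(b has_integral 1) {c..d}"
    by (rule has_integral_on_superset[OF b(4)]) (use b(3) h in auto)
  have cont: "continuous_on {c..d} (\<lambda>x. complex_of_real (b x))"
    by (intro continuous_intros bump_algebra_continuous_on b)
  have "((\<lambda>x. complex_of_real (b x)) has_integral of_real 1) {c..d}"
    using has_integral_linear[OF 1 bounded_linear_of_real] by (simp add: o_def)
  from has_integral_mult_left[OF this, of "g s"]
  have "((\<lambda>x. of_real (b x) * g s) has_integral g s) {c..d}" by simp
  moreover have "((\<lambda>x. of_real (b x) * g x) has_integral integral {c..d} (\<lambda>x. of_real (b x) * g x)) {c..d}"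
    by (intro integrable_integral integrable_continuous_real continuous_on_mult cont g)
  ultimately
  have diff: "((\<lambda>x. of_real (b x) * g x - of_real (b x) * g s) has_integral
      (integral {c..d} (\<lambda>x. of_real (b x) * g x) - g s)) {c..d}"
    by (rule has_integral_diff[rotated])
  have "norm (integral {c..d} (\<lambda>x. of_real (b x) * g x - of_real (b x) * g s)) \<le> integral {c..d} (\<lambda>x. b x * e)"
  proof (rule integral_norm_bound_integral)
    fix x assume x: "x \<in> {c..d}"
    have "norm (g x - g s) \<le> e" if "b x \<noteq> 0"
      using \<delta>(2)[OF x] b(3)[of x] h that by (cases "x \<in> {s - h<..<s + h}") (auto simp: dist_norm abs_less_iff)
    then show "norm (of_real (b x) * g x - of_real (b x) * g s) \<le> b x * e"
      using b(2)[of x] by (cases "b x = 0") (auto simp: norm_mult simp flip: right_diff_distrib)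
  qed (use diff has_integral_mult_left[OF 1, of e] in auto)
  moreover have "integral {c..d} (\<lambda>x. b x * e) = e"
    using has_integral_mult_left[OF 1, of e] by (intro integral_unique) simp
  ultimately have "norm (integral {c..d} (\<lambda>x. of_real (b x) * g x) - g s) \<le> e"
    unfolding integral_unique[OF diff] by linarith
  with b h 1 show ?thesis by (intro that[of b "s - h" "s + h"]) auto
qed

text \<open>The difference of two unit-mass bumps, concentrated near \<open>s\<close> and near \<open>t\<close>, has mass zero and is
  thus the derivative of a test function. Orthogonality says that the two averages of \<open>g\<close> agree,
  and they approximate \<open>g s\<close> and \<open>g t\<close>.\<close>

lemma du_Bois_Reymond:
  fixes g :: "real \<Rightarrow> complex"
  assumes "c < d" and g: "continuous_on {c..d} g"
    and orth: "\<And>\<phi>. \<phi> \<in> test_functions c d \<Longrightarrow> integral {c..d} (\<lambda>x. of_real (deriv \<phi> x) * g x) = 0"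
  shows "\<exists>k. \<forall>x\<in>{c..d}. g x = k"
proof -
  have eq: "g s = g t" if st: "s \<in> {c<..<d}" "t \<in> {c<..<d}" for s t
  proof (rule ccontr)
    assume "g s \<noteq> g t"
    then have e: "0 < norm (g s - g t) / 3" by simp
    obtain b l r where b: "b \<in> bump_algebra" "c < l" "l < r" "r < d"
      "\<And>x. x \<notin> {l<..<r} \<Longrightarrow> b x = 0" "(b has_integral 1) {c..d}"
      "norm (integral {c..d} (\<lambda>x. of_real (b x) * g x) - g s) \<le> norm (g s - g t) / 3"
      using bump_average_approximates[OF g st(1) e] by blast
    obtain b' l' r' where b': "b' \<in> bump_algebra" "c < l'" "l' < r'" "r' < d"
      "\<And>x. x \<notin> {l'<..<r'} \<Longrightarrow> b' x = 0" "(b' has_integral 1) {c..d}"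
      "norm (integral {c..d} (\<lambda>x. of_real (b' x) * g x) - g t) \<le> norm (g s - g t) / 3"
      using bump_average_approximates[OF g st(2) e] by blast
    let ?\<beta> = "\<lambda>x. b x + - 1 * b' x"
    have zero: "?\<beta> x = 0" if "x \<notin> {min l l'<..<max r r'}" for x using that b(5)[of x] b'(5)[of x] by (auto simp: min_def max_def split: if_splits)
    have total: "(?\<beta> has_integral (1 + - 1 * 1)) {c..d}"
      by (intro has_integral_add has_integral_mult_right b b')
    have restr: "(?\<beta> has_integral integral {min l l'..max r r'} ?\<beta>) {min l l'..max r r'}"
      by (intro integrable_integral integrable_continuous_real bump_algebra_continuous_on
          bump_algebra.add[OF b(1) bump_algebra.cmult[OF b'(1)]])
    then have "(?\<beta> has_integral integral {min l l'..max r r'} ?\<beta>) {c..d}"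
      by (rule has_integral_on_superset) (use zero b b' in auto)
    from has_integral_unique[OF this total] restr
    have "(?\<beta> has_integral 0) {min l l'..max r r'}" by simp
    then obtain \<phi> where \<phi>: "\<phi> \<in> test_functions c d" "deriv \<phi> = ?\<beta>"
      using zero b b' bump_algebra.add[OF b(1) bump_algebra.cmult[OF b'(1), of "- 1"]]
      by (elim test_function_with_derivative[of ?\<beta> c "min l l'" "max r r'" d, rotated -1]) auto
    have cont: "(\<lambda>x. of_real (f x) * g x) integrable_on {c..d}" if "f \<in> bump_algebra" for f
      by (intro integrable_continuous_real continuous_intros bump_algebra_continuous_on that g)
    have "0 = integral {c..d} (\<lambda>x. of_real (b x) * g x - of_real (b' x) * g x)"
      using orth[OF \<phi>(1)] by (simp add: \<phi>(2) algebra_simps)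
    also have "\<dots> = integral {c..d} (\<lambda>x. of_real (b x) * g x) - integral {c..d} (\<lambda>x. of_real (b' x) * g x)"
      by (intro integral_diff cont b b')
    finally have "g s - g t = (integral {c..d} (\<lambda>x. of_real (b' x) * g x) - g t)
        - (integral {c..d} (\<lambda>x. of_real (b x) * g x) - g s)" by simp
    then have "norm (g s - g t) \<le> norm (integral {c..d} (\<lambda>x. of_real (b' x) * g x) - g t)
        + norm (integral {c..d} (\<lambda>x. of_real (b x) * g x) - g s)"
      by (metis norm_triangle_ineq4)
    with b(7) b'(7) e show False by simp
  qed
  have "g x = g ((c + d) / 2)" if "x \<in> {c..d}" for x
  proof (rule continuous_constant_on_closure[of "{c<..<d}" g])
    show "continuous_on (closure {c<..<d}) g" using g \<open>c < d\<close> by simp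
    show "x \<in> closure {c<..<d}" using that \<open>c < d\<close> by simp
    show "g y = g ((c + d) / 2)" if "y \<in> {c<..<d}" for y using \<open>c < d\<close> by (intro eq that) auto
  qed
  then show ?thesis by blast
qed

section \<open>Weak derivatives as integrands of primitives\<close>

lemma test_function_deriv_has_derivative:
  assumes "\<phi> \<in> test_functions c d"
  shows "((deriv ^^ n) \<phi> has_field_derivative (deriv ^^ Suc n) \<phi> x) (at x)"
  using assms by (simp add: test_functions_def field_differentiable_derivI)

lemma test_function_deriv_vanishes:
  assumes "\<phi> \<in> test_functions c d" and "x \<notin> {c<..<d}"
  shows "(deriv ^^ n) \<phi> x = 0"
proof -
  let ?K = "closure {x. \<phi> x \<noteq> 0}"
  have "\<forall>x\<in>- ?K. (deriv ^^ n) \<phi> x = 0"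
  proof (induction n)
    case 0
    then show ?case using closure_subset[of "{x. \<phi> x \<noteq> 0}"] by auto
  next
    case (Suc n)
    show ?case
    proof
      fix x assume x: "x \<in> - ?K"
      have "((\<lambda>x. 0) has_field_derivative 0) (at x)" by simp
      then have "((deriv ^^ n) \<phi> has_field_derivative 0) (at x)"
        by (rule has_field_derivative_transform_within_open[of _ _ _ "- ?K"]) (use x Suc in auto)
      then show "(deriv ^^ Suc n) \<phi> x = 0" by (simp add: DERIV_imp_deriv)
    qed
  qed
  with assms show ?thesis by (auto simp: test_functions_def)
qed

lemma test_function_deriv_primitive:
  assumes "\<phi> \<in> test_functions c d"
  shows "primitive c d (\<lambda>x. of_real ((deriv ^^ n) \<phi> x)) (\<lambda>x. of_real ((deriv ^^ Suc n) \<phi> x))"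
proof (rule primitive_of_vector_derivative)
  show "((\<lambda>x. complex_of_real ((deriv ^^ n) \<phi> x)) has_vector_derivative of_real ((deriv ^^ Suc n) \<phi> x))
      (at x within {c..d})" for x
    using test_function_deriv_has_derivative[OF assms]
    by (simp only: has_real_derivative_iff_has_vector_derivative
        has_vector_derivative_of_real has_vector_derivative_at_within)
  have "isCont ((deriv ^^ Suc n) \<phi>) x" for x
    by (rule DERIV_isCont[OF test_function_deriv_has_derivative[OF assms]])
  then show "continuous_on {c..d} (\<lambda>x. complex_of_real ((deriv ^^ Suc n) \<phi> x))"
    by (intro continuous_on_of_real continuous_at_imp_continuous_on) auto
qed

lemma test_function_deriv_L_inf:
  assumes "\<phi> \<in> test_functions c d"
  shows "(\<lambda>x. complex_of_real ((deriv ^^ n) \<phi> x)) \<in> L_inf c d"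
  by (rule L_inf_continuous[OF primitive_continuous_on[OF test_function_deriv_primitive[OF assms]]])

lemma integration_by_parts_test_function:
  assumes \<phi>: "\<phi> \<in> test_functions c d" and F: "primitive c d F f" and "c \<le> d"
  shows "integral {c..d} (\<lambda>x. of_real ((deriv ^^ Suc n) \<phi> x) * F x)
    = - integral {c..d} (\<lambda>x. of_real ((deriv ^^ n) \<phi> x) * f x)"
proof -
  let ?D = "\<lambda>n x. complex_of_real ((deriv ^^ n) \<phi> x)"
  note L = primitive_L_inf[OF F]
  have "((\<lambda>x. ?D (Suc n) x * F x + ?D n x * f x) has_integral ?D n d * F d - ?D n c * F c) {c..d}"
    using primitive_mult[OF test_function_deriv_primitive[OF \<phi>] F] \<open>c \<le> d\<close>
    by (intro primitive_has_integral[of c d "\<lambda>x. ?D n x * F x"]) auto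
  then have "integral {c..d} (\<lambda>x. ?D (Suc n) x * F x + ?D n x * f x) = 0"
    by (simp add: test_function_deriv_vanishes[OF \<phi>] integral_unique)
  moreover have "integral {c..d} (\<lambda>x. ?D (Suc n) x * F x + ?D n x * f x)
      = integral {c..d} (\<lambda>x. ?D (Suc n) x * F x) + integral {c..d} (\<lambda>x. ?D n x * f x)"
    by (rule integral_add; rule L_inf_mult_integrable_on; rule test_function_deriv_L_inf[OF \<phi>] L)
  ultimately show ?thesis by (simp add: eq_neg_iff_add_eq_0)
qed

lemma weak_deriv_iff_integral:
  assumes "u \<in> L_inf c d" and "w \<in> L_inf c d"
  shows "weak_deriv k c d u w \<longleftrightarrow> (\<forall>\<phi>\<in>test_functions c d.
    integral {c..d} (\<lambda>x. of_real ((deriv ^^ k) \<phi> x) * u x)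
      = (- 1) ^ k * integral {c..d} (\<lambda>x. of_real (\<phi> x) * w x))"
  unfolding weak_deriv_def scaleR_conv_of_real
  using assms test_function_deriv_L_inf[of _ c d k] test_function_deriv_L_inf[of _ c d 0]
  by (intro ball_cong refl) (simp add: L_inf_lebesgue_integral L_inf_mult)

lemma weak_deriv_1_if_primitive:
  assumes u: "primitive c d u v" and "c \<le> d"
  shows "weak_deriv 1 c d u v"
proof -
  note L = primitive_L_inf[OF u]
  show ?thesis
    unfolding weak_deriv_iff_integral[OF L]
    using integration_by_parts_test_function[OF _ u \<open>c \<le> d\<close>, of _ 0] by simp
qed

text \<open>With \<open>W\<close> a primitive of \<open>w\<close>, integrating by parts once on each side turns the weak identity
  into the orthogonality of \<open>v - W\<close> to all \<open>deriv \<phi>\<close>. By du Bois-Reymond that means that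
  \<open>v - W\<close> is constant.\<close>

lemma weak_deriv_2_iff_primitive:
  assumes u: "primitive c d u v" and v: "continuous_on {c..d} v" and w: "w \<in> L_inf c d" and "c < d"
  shows "weak_deriv 2 c d u w \<longleftrightarrow> primitive c d v w"
proof -
  have cd: "c \<le> d" using \<open>c < d\<close> by simp
  note L = primitive_L_inf(1)[OF u]
  define W where "W x = 0 + integral {c..x} w" for x
  have W: "primitive c d W w" unfolding W_def by (rule primitive_integral[OF w])
  have swap: "A = C \<longleftrightarrow> B = D" if "A = - B" "D = - C" for A B C D :: complex
    using that by auto
  have "weak_deriv 2 c d u w \<longleftrightarrow> (\<forall>\<phi>\<in>test_functions c d.
      integral {c..d} (\<lambda>x. of_real (deriv \<phi> x) * v x) = integral {c..d} (\<lambda>x. of_real (deriv \<phi> x) * W x))"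
    unfolding weak_deriv_iff_integral[OF L w]
  proof (intro ball_cong refl)
    fix \<phi> assume \<phi>: "\<phi> \<in> test_functions c d"
    show "integral {c..d} (\<lambda>x. of_real ((deriv ^^ 2) \<phi> x) * u x)
          = (- 1) ^ 2 * integral {c..d} (\<lambda>x. of_real (\<phi> x) * w x)
        \<longleftrightarrow> integral {c..d} (\<lambda>x. of_real (deriv \<phi> x) * v x) = integral {c..d} (\<lambda>x. of_real (deriv \<phi> x) * W x)"
      using swap[OF integration_by_parts_test_function[OF \<phi> u cd, of 1]
          integration_by_parts_test_function[OF \<phi> W cd, of 0]]
      by (simp add: numeral_2_eq_2)
  qed
  also have "\<dots> \<longleftrightarrow> (\<forall>\<phi>\<in>test_functions c d. integral {c..d} (\<lambda>x. of_real (deriv \<phi> x) * (v x - W x)) = 0)"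
  proof (intro ball_cong refl)
    fix \<phi> assume \<phi>: "\<phi> \<in> test_functions c d"
    have "integral {c..d} (\<lambda>x. of_real (deriv \<phi> x) * (v x - W x))
        = integral {c..d} (\<lambda>x. of_real (deriv \<phi> x) * v x - of_real (deriv \<phi> x) * W x)"
      by (simp add: algebra_simps)
    also have "\<dots> = integral {c..d} (\<lambda>x. of_real (deriv \<phi> x) * v x) - integral {c..d} (\<lambda>x. of_real (deriv \<phi> x) * W x)"
      using test_function_deriv_L_inf[OF \<phi>, of 1] L_inf_continuous[OF v]
        L_inf_continuous[OF primitive_continuous_on[OF W]]
      by (intro integral_diff; intro L_inf_mult_integrable_on; simp)
    finally show "integral {c..d} (\<lambda>x. of_real (deriv \<phi> x) * v x) = integral {c..d} (\<lambda>x. of_real (deriv \<phi> x) * W x)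
        \<longleftrightarrow> integral {c..d} (\<lambda>x. of_real (deriv \<phi> x) * (v x - W x)) = 0" by simp
  qed
  also have "\<dots> \<longleftrightarrow> primitive c d v w"
  proof
    assume "\<forall>\<phi>\<in>test_functions c d. integral {c..d} (\<lambda>x. of_real (deriv \<phi> x) * (v x - W x)) = 0"
    then obtain k where k: "\<forall>x\<in>{c..d}. v x - W x = k"
      using du_Bois_Reymond[of c d "\<lambda>x. v x - W x"] \<open>c < d\<close> v primitive_continuous_on[OF W]
      by (auto intro: continuous_intros)
    show "primitive c d v w"
      by (rule primitive_cong[OF primitive_integral[OF w, of k]])
         (use k in \<open>auto simp: W_def diff_eq_eq add.commute\<close>)
  next
    assume pv: "primitive c d v w"
    have "v x - W x = v c" if "x \<in> {c..d}" for x
      using primitive_has_integral[OF pv order.refl, of x] that by (simp add: W_def integral_unique)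
    then have "integral {c..d} (\<lambda>x. of_real (deriv \<phi> x) * (v x - W x))
        = integral {c..d} (\<lambda>x. of_real (deriv \<phi> x) * v c)" for \<phi>
      by (intro integral_cong) simp
    moreover have "integral {c..d} (\<lambda>x. of_real (deriv \<phi> x) * v c) = 0" if "\<phi> \<in> test_functions c d" for \<phi>
    proof -
      have "primitive c d (\<lambda>_. v c) (\<lambda>_. 0)"
        by (rule primitive_of_vector_derivative) auto
      from integration_by_parts_test_function[OF that this cd, of 0] show ?thesis by simp
    qed
    ultimately show "\<forall>\<phi>\<in>test_functions c d. integral {c..d} (\<lambda>x. of_real (deriv \<phi> x) * (v x - W x)) = 0"
      by simp
  qed
  finally show ?thesis .
qed

section \<open>The Cauchy problem\<close>

text \<open>The operator \<open>f \<mapsto> \<integral>\<integral> q f\<close>: a function \<open>u\<close> satisfies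
  \<open>u'' = q u\<close> if and only if \<open>u - volterra c q u\<close> is affine.\<close>

definition volterra :: "real \<Rightarrow> (real \<Rightarrow> complex) \<Rightarrow> (real \<Rightarrow> complex) \<Rightarrow> real \<Rightarrow> complex" where
  "volterra c q f x = integral {c..x} (\<lambda>s. integral {c..s} (\<lambda>t. q t * f t))"

lemma volterra_primitives:
  assumes "q \<in> L_inf c d" and "continuous_on {c..d} f"
  shows "primitive c d (\<lambda>s. integral {c..s} (\<lambda>t. q t * f t)) (\<lambda>t. q t * f t)"
    and "primitive c d (volterra c q f) (\<lambda>s. integral {c..s} (\<lambda>t. q t * f t))"
proof -
  have "(\<lambda>t. q t * f t) \<in> L_inf c d" by (rule L_inf_mult[OF assms(1) L_inf_continuous[OF assms(2)]])
  from primitive_integral[OF this, of 0]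
  show inner: "primitive c d (\<lambda>s. integral {c..s} (\<lambda>t. q t * f t)) (\<lambda>t. q t * f t)" by simp
  from primitive_integral[OF primitive_L_inf(1)[OF this], of 0]
  show "primitive c d (volterra c q f) (\<lambda>s. integral {c..s} (\<lambda>t. q t * f t))"
    by (simp add: volterra_def[abs_def])
qed

lemma volterra_continuous_on:
  assumes "q \<in> L_inf c d" and "continuous_on {c..d} f"
  shows "continuous_on {c..d} (volterra c q f)"
  by (rule primitive_continuous_on[OF volterra_primitives(2)[OF assms]])

lemma volterra_funpow_continuous_on:
  assumes "q \<in> L_inf c d" and "continuous_on {c..d} f"
  shows "continuous_on {c..d} ((volterra c q ^^ n) f)"
  using assms by (induction n) (auto intro: volterra_continuous_on)

lemma volterra_cong:
  assumes "\<And>t. t \<in> {c..d} \<Longrightarrow> f t = g t" and "x \<in> {c..d}"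
  shows "volterra c q f x = volterra c q g x"
  unfolding volterra_def using assms by (intro integral_cong) auto

lemma volterra_add:
  assumes q: "q \<in> L_inf c d" and f: "continuous_on {c..d} f" and g: "continuous_on {c..d} g"
    and x: "x \<in> {c..d}"
  shows "volterra c q (\<lambda>t. f t + g t) x = volterra c q f x + volterra c q g x"
proof -
  let ?I = "\<lambda>f s. integral {c..s} (\<lambda>t. q t * f t)"
  have "?I (\<lambda>t. f t + g t) s = ?I f s + ?I g s" if "s \<in> {c..x}" for s
  proof -
    have "(\<lambda>t. q t * f t) integrable_on {c..s}" "(\<lambda>t. q t * g t) integrable_on {c..s}"
      using that x L_inf_mult[OF q L_inf_continuous[OF f]] L_inf_mult[OF q L_inf_continuous[OF g]]
      by (auto intro: L_inf_integrable_on)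
    then show ?thesis by (simp add: distrib_left integral_add)
  qed
  then have "volterra c q (\<lambda>t. f t + g t) x = integral {c..x} (\<lambda>s. ?I f s + ?I g s)"
    unfolding volterra_def by (rule integral_cong)
  also have "\<dots> = volterra c q f x + volterra c q g x"
    unfolding volterra_def using x
    by (intro integral_add L_inf_integrable_on[of _ c d]
        primitive_L_inf(1)[OF volterra_primitives(1)[OF q f]]
        primitive_L_inf(1)[OF volterra_primitives(1)[OF q g]]) auto
  finally show ?thesis .
qed

lemma volterra_sum:
  assumes q: "q \<in> L_inf c d" and f: "\<And>i. continuous_on {c..d} (f i)" and x: "x \<in> {c..d}"
  shows "volterra c q (\<lambda>t. \<Sum>i<n. f i t) x = (\<Sum>i<(n::nat). volterra c q (f i) x)"
proof (induction n)
  case 0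
  show ?case by (simp add: volterra_def)
next
  case (Suc n)
  have "continuous_on {c..d} (\<lambda>t. \<Sum>i<n. f i t)" by (intro continuous_on_sum f)
  from volterra_add[OF q this f x] Suc show ?case by simp
qed

text \<open>The factorial is what makes the Neumann series converge on an interval of any length; the same
  bound, applied to a fixed point of the operator, gives uniqueness.\<close>

lemma volterra_funpow_bound:
  assumes q: "q \<in> L_inf c d"
  shows "\<exists>K\<ge>0. \<forall>f M n x. continuous_on {c..d} f \<longrightarrow> (\<forall>t\<in>{c..d}. norm (f t) \<le> M) \<longrightarrow> x \<in> {c..d} \<longrightarrow>
    norm ((volterra c q ^^ n) f x) \<le> M * ((K * (x - c)) ^ n / fact n)"
proof -
  obtain B N where B: "0 \<le> B" "negligible N" "\<And>x. x \<in> {c..d} - N \<Longrightarrow> norm (q x) \<le> B"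
    using L_inf_bound_off_negligible[OF q] by blast
  \<comment> \<open>The inner integral is estimated crudely by the length of the interval; only the
    outer one has to produce the factor \<open>1 / (n + 1)\<close>.\<close>
  define K where "K = B * \<bar>d - c\<bar>"
  have K: "0 \<le> K" using B(1) by (simp add: K_def)
  have "norm ((volterra c q ^^ n) f x) \<le> M * ((K * (x - c)) ^ n / fact n)"
    if f: "continuous_on {c..d} f" and M: "\<And>t. t \<in> {c..d} \<Longrightarrow> norm (f t) \<le> M" and x: "x \<in> {c..d}"
    for f M n x
    using x
  proof (induction n arbitrary: x)
    case 0
    then show ?case using M by simp
  next
    case (Suc n)
    let ?T = "(volterra c q ^^ n) f"
    let ?I = "\<lambda>s. integral {c..s} (\<lambda>t. q t * ?T t)"
    have "0 \<le> M" using M[OF Suc.prems] norm_ge_zero order_trans by blast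
    have T: "continuous_on {c..d} ?T" by (rule volterra_funpow_continuous_on[OF q f])
    have inner: "norm (?I s) \<le> M * K ^ Suc n / fact n * (s - c) ^ n" if s: "s \<in> {c..x}" for s
    proof -
      have sd: "s \<in> {c..d}" using s Suc.prems by auto
      let ?C = "B * (M * ((K * (s - c)) ^ n / fact n))"
      have "((\<lambda>t. q t * ?T t) has_integral ?I s) {c..s}"
        using sd by (intro integrable_integral L_inf_integrable_on[of _ c d] L_inf_mult q
            L_inf_continuous[OF T]) auto
      then have "norm (?I s) \<le> ?C * (s - c)"
      proof (rule has_integral_bound_off_negligible[OF _ B(2)])
        show "0 \<le> ?C" using B(1) \<open>0 \<le> M\<close> K s by simp
        fix t assume t: "t \<in> {c..s} - N"
        have "norm (?T t) \<le> M * ((K * (t - c)) ^ n / fact n)"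
          using t sd by (intro Suc.IH) auto
        also have "\<dots> \<le> M * ((K * (s - c)) ^ n / fact n)"
          using t \<open>0 \<le> M\<close> K by (intro mult_left_mono divide_right_mono power_mono) auto
        finally show "norm (q t * ?T t) \<le> ?C"
          unfolding norm_mult using B t sd by (intro mult_mono) auto
      qed (use s in auto)
      also have "\<dots> \<le> ?C * \<bar>d - c\<bar>"
        using sd B(1) \<open>0 \<le> M\<close> K by (intro mult_left_mono) auto
      also have "\<dots> = M * K ^ Suc n / fact n * (s - c) ^ n"
        by (simp add: K_def power_mult_distrib)
      finally show ?thesis .
    qed
    have power: "((\<lambda>s. (s - c) ^ n) has_integral ((x - c) ^ Suc n / Suc n - (c - c) ^ Suc n / Suc n)) {c..x}"
    proof (rule fundamental_theorem_of_calculus)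
      fix s
      have "((\<lambda>s. (s - c) ^ Suc n / Suc n) has_real_derivative (s - c) ^ n) (at s within {c..x})"
        by (auto intro!: derivative_eq_intros simp del: power_Suc of_nat_Suc)
      then show "((\<lambda>s. (s - c) ^ Suc n / Suc n) has_vector_derivative (s - c) ^ n) (at s within {c..x})"
        by (simp add: has_real_derivative_iff_has_vector_derivative)
    qed (use Suc.prems in auto)
    from has_integral_mult_right[OF this, of "M * K ^ Suc n / fact n"]
    have power': "((\<lambda>s. M * K ^ Suc n / fact n * (s - c) ^ n) has_integral
        M * ((K * (x - c)) ^ Suc n / fact (Suc n))) {c..x}"
      by (simp add: power_mult_distrib mult_ac)
    have "norm (integral {c..x} ?I) \<le> integral {c..x} (\<lambda>s. M * K ^ Suc n / fact n * (s - c) ^ n)"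
    proof (rule integral_norm_bound_integral)
      show "?I integrable_on {c..x}"
        using Suc.prems
        by (intro L_inf_integrable_on[OF primitive_L_inf(1)[OF volterra_primitives(1)[OF q T]]]) auto
    qed (use power' inner in auto)
    also have "\<dots> = M * ((K * (x - c)) ^ Suc n / fact (Suc n))"
      by (rule integral_unique[OF power'])
    finally show ?case by (simp add: volterra_def[of c q ?T])
  qed
  with K show ?thesis by blast
qed

text \<open>The equation \<open>u'' = q u\<close> as a first-order system in integral form, with \<open>v = u'\<close>. In this form
  restriction, scaling and subtraction of solutions are immediate.\<close>

definition solves :: "real \<Rightarrow> real \<Rightarrow> (real \<Rightarrow> complex) \<Rightarrow> (real \<Rightarrow> complex) \<Rightarrow> (real \<Rightarrow> complex) \<Rightarrow> bool" where
  "solves c d q u v \<longleftrightarrow> primitive c d u v \<and> primitive c d v (\<lambda>x. q x * u x)"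

lemma solves_subset: "solves c d q u v \<Longrightarrow> c \<le> c' \<Longrightarrow> d' \<le> d \<Longrightarrow> solves c' d' q u v"
  by (auto simp: solves_def intro: primitive_subset)

lemma solves_cmult:
  assumes "solves c d q u v"
  shows "solves c d q (\<lambda>x. k * u x) (\<lambda>x. k * v x)"
  using assms primitive_cmult[of c d u v k] primitive_cmult[of c d v "\<lambda>x. q x * u x" k]
  by (simp add: solves_def mult.left_commute)

lemma solves_diff:
  assumes "solves c d q u v" and "solves c d q u' v'"
  shows "solves c d q (\<lambda>x. u x - u' x) (\<lambda>x. v x - v' x)"
  using assms(1) solves_cmult[OF assms(2), of "- 1"]
    primitive_add[of c d u v "\<lambda>x. - 1 * u' x" "\<lambda>x. - 1 * v' x"]
    primitive_add[of c d v "\<lambda>x. q x * u x" "\<lambda>x. - 1 * v' x" "\<lambda>x. q x * (- 1 * u' x)"]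
  by (simp add: solves_def right_diff_distrib)

text \<open>With zero data \<open>u\<close> is a fixed point of the Volterra operator, hence equal to all its iterates,
  and these tend to \<open>0\<close>.\<close>

lemma solves_zero_initial_data:
  assumes uv: "solves c d q u v" and q: "q \<in> L_inf c d" and init: "u c = 0" "v c = 0"
    and x: "x \<in> {c..d}"
  shows "u x = 0"
proof -
  have u: "primitive c d u v" and v: "primitive c d v (\<lambda>x. q x * u x)"
    using uv by (auto simp: solves_def)
  note cont = primitive_continuous_on[OF u]
  have v_eq: "integral {c..s} (\<lambda>t. q t * u t) = v s" if "s \<in> {c..d}" for s
    using primitive_has_integral[OF v order.refl, of s] init that by (simp add: integral_unique)
  have fixed: "volterra c q u y = u y" if y: "y \<in> {c..d}" for y
  proof -
    have "volterra c q u y = integral {c..y} v"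
      unfolding volterra_def using y by (intro integral_cong v_eq) auto
    then show ?thesis
      using primitive_has_integral[OF u order.refl, of y] init y by (simp add: integral_unique)
  qed
  have iterate: "(volterra c q ^^ n) u y = u y" if "y \<in> {c..d}" for n y
    using that
  proof (induction n arbitrary: y)
    case (Suc n)
    have "(volterra c q ^^ Suc n) u y = volterra c q u y"
      using Suc by (auto intro!: volterra_cong)
    then show ?case using fixed Suc.prems by simp
  qed simp
  obtain M where M: "\<And>t. t \<in> {c..d} \<Longrightarrow> norm (u t) \<le> M"
    using compact_imp_bounded[OF compact_continuous_image[OF cont compact_Icc]]
    unfolding bounded_iff by blast
  obtain K where K: "0 \<le> K" "\<forall>f M n x. continuous_on {c..d} f \<longrightarrow>
      (\<forall>t\<in>{c..d}. norm (f t) \<le> M) \<longrightarrow> x \<in> {c..d} \<longrightarrow>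
      norm ((volterra c q ^^ n) f x) \<le> M * ((K * (x - c)) ^ n / fact n)"
    using volterra_funpow_bound[OF q] by (elim exE conjE)
  have "norm (u x) \<le> M * ((K * (x - c)) ^ n / fact n)" for n
    using K(2)[rule_format, OF cont M x, of n] iterate[OF x] by simp
  moreover have "(\<lambda>n. M * ((K * (x - c)) ^ n / fact n)) \<longlonglongrightarrow> M * 0"
    using summable_LIMSEQ_zero[OF summable_exp[of "K * (x - c)"]]
    by (intro tendsto_mult_left) (simp add: divide_inverse mult.commute)
  ultimately have "norm (u x) \<le> M * 0"
    by (intro LIMSEQ_le_const[of _ "M * 0"]) auto
  then show ?thesis by simp
qed

lemma solves_unique:
  assumes "solves c d q u v" and "solves c d q u' v'" and "q \<in> L_inf c d"
    and "u c = u' c" and "v c = v' c" and "x \<in> {c..d}"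
  shows "u x = u' x"
  using solves_zero_initial_data[OF solves_diff[OF assms(1,2)] assms(3) _ _ assms(6)] assms(4,5) by simp

text \<open>The solution is the Neumann series of \<open>f\<close>. It converges uniformly, which allows the operator to
  be applied term by term.\<close>

lemma volterra_equation_solvable:
  assumes q: "q \<in> L_inf c d" and f: "continuous_on {c..d} f"
  obtains u where "continuous_on {c..d} u" "\<And>x. x \<in> {c..d} \<Longrightarrow> u x = f x + volterra c q u x"
proof -
  let ?T = "\<lambda>n. (volterra c q ^^ n) f"
  obtain M where M: "\<And>t. t \<in> {c..d} \<Longrightarrow> norm (f t) \<le> M"
    using compact_imp_bounded[OF compact_continuous_image[OF f compact_Icc]]
    unfolding bounded_iff by blast
  obtain K where K: "0 \<le> K" "\<forall>f M n x. continuous_on {c..d} f \<longrightarrow>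
      (\<forall>t\<in>{c..d}. norm (f t) \<le> M) \<longrightarrow> x \<in> {c..d} \<longrightarrow>
      norm ((volterra c q ^^ n) f x) \<le> M * ((K * (x - c)) ^ n / fact n)"
    using volterra_funpow_bound[OF q] by (elim exE conjE)
  define u where "u x = (\<Sum>n. ?T n x)" for x
  have unif: "uniform_limit {c..d} (\<lambda>n x. \<Sum>i<n. ?T i x) u sequentially"
    unfolding u_def[abs_def]
  proof (rule Weierstrass_m_test)
    fix n x assume x: "x \<in> {c..d}"
    have "0 \<le> M" using M[OF x] norm_ge_zero order_trans by blast
    have "norm (?T n x) \<le> M * ((K * (x - c)) ^ n / fact n)" by (rule K(2)[rule_format, OF f M x])
    also have "\<dots> \<le> M * ((K * \<bar>d - c\<bar>) ^ n / fact n)"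
      using x K(1) \<open>0 \<le> M\<close> by (intro mult_left_mono divide_right_mono power_mono) auto
    finally show "norm (?T n x) \<le> M * ((K * \<bar>d - c\<bar>) ^ n / fact n)" .
  next
    show "summable (\<lambda>n. M * ((K * \<bar>d - c\<bar>) ^ n / fact n))"
      using summable_mult[OF summable_exp[of "K * \<bar>d - c\<bar>"], of M] by (simp add: field_simps)
  qed
  have cont_sum: "continuous_on {c..d} (\<lambda>x. \<Sum>i<n. ?T i x)" for n
    by (intro continuous_on_sum volterra_funpow_continuous_on q f)
  have u: "continuous_on {c..d} u"
    by (rule uniform_limit_theorem[OF _ unif]) (auto simp: cont_sum)
  have "u x = f x + volterra c q u x" if x: "x \<in> {c..d}" for x
  proof -
    have partial: "volterra c q (\<lambda>t. \<Sum>i<n. ?T i t) x = (\<Sum>i<Suc n. ?T i x) - f x" for n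
      using volterra_sum[OF q volterra_funpow_continuous_on[OF q f] x, of "\<lambda>i. i" n]
      by (simp add: sum.lessThan_Suc_shift del: sum.lessThan_Suc)
    have "(\<lambda>n. \<Sum>i<n. ?T i x) \<longlonglongrightarrow> u x" by (rule tendsto_uniform_limitI[OF unif x])
    then have "(\<lambda>n. (\<Sum>i<Suc n. ?T i x) - f x) \<longlonglongrightarrow> u x - f x"
      by (intro tendsto_diff tendsto_const LIMSEQ_Suc)
    moreover have "(\<lambda>n. volterra c q (\<lambda>t. \<Sum>i<n. ?T i t) x) \<longlonglongrightarrow> volterra c q u x"
    proof (rule LIMSEQ_I)
      fix r :: real assume r: "0 < r"
      define e where "e = r / (K * (x - c) + 1)"
      have pos: "0 < K * (x - c) + 1" using K(1) x by (simp add: add_nonneg_pos)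
      then have e: "0 < e" using r by (simp add: e_def)
      obtain n0 where n0: "\<And>n t. n0 \<le> n \<Longrightarrow> t \<in> {c..d} \<Longrightarrow> dist (\<Sum>i<n. ?T i t) (u t) < e"
        using uniform_limitD[OF unif e] unfolding eventually_sequentially by blast
      show "\<exists>n0. \<forall>n\<ge>n0. norm (volterra c q (\<lambda>t. \<Sum>i<n. ?T i t) x - volterra c q u x) < r"
      proof (intro exI allI impI)
        fix n assume n: "n0 \<le> n"
        let ?D = "\<lambda>t. (\<Sum>i<n. ?T i t) - u t"
        have D: "continuous_on {c..d} ?D" by (intro continuous_on_diff cont_sum u)
        have "volterra c q (\<lambda>t. \<Sum>i<n. ?T i t) x = volterra c q ?D x + volterra c q u x"
          using volterra_add[OF q D u x] by simp
        moreover have "norm ((volterra c q ^^ 1) ?D x) \<le> e * ((K * (x - c)) ^ 1 / fact 1)"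
          using n0[OF n] by (intro K(2)[rule_format, OF D _ x]) (auto simp: dist_norm less_imp_le)
        moreover have "e * (K * (x - c)) < r"
          using pos r by (simp add: e_def field_simps)
        ultimately show "norm (volterra c q (\<lambda>t. \<Sum>i<n. ?T i t) x - volterra c q u x) < r" by simp
      qed
    qed
    ultimately have "volterra c q u x = u x - f x"
      unfolding partial using LIMSEQ_unique by blast
    then show ?thesis by simp
  qed
  with u show ?thesis by (rule that)
qed

lemma solves_exists:
  assumes q: "q \<in> L_inf c d" and "c \<le> d"
  obtains u v where "solves c d q u v" "u c = y0" "v c = y1"
proof -
  let ?f = "\<lambda>x. y0 + of_real (x - c) * y1"
  have f: "continuous_on {c..d} ?f" by (intro continuous_intros)
  obtain u where u: "continuous_on {c..d} u" "\<And>x. x \<in> {c..d} \<Longrightarrow> u x = ?f x + volterra c q u x"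
    using volterra_equation_solvable[OF q f] by blast
  define v where "v x = y1 + integral {c..x} (\<lambda>t. q t * u t)" for x
  have "primitive c d v (\<lambda>t. q t * u t)"
    unfolding v_def by (intro primitive_integral L_inf_mult q L_inf_continuous u)
  moreover have "primitive c d ?f (\<lambda>_. y1)"
    by (rule primitive_of_vector_derivative) (auto intro!: derivative_eq_intros)
  from primitive_cong[OF primitive_add[OF this volterra_primitives(2)[OF q u(1)]] u(2)]
  have "primitive c d u v" by (simp add: v_def[abs_def])
  moreover have "u c = y0" "v c = y1" using u(2)[of c] \<open>c \<le> d\<close> by (auto simp: v_def volterra_def)
  ultimately show ?thesis using that by (auto simp: solves_def)
qed

text \<open>The derivative of \<open>cnj u * v\<close> is \<open>cnj v * v + q * (cnj u * u)\<close>, which is real.\<close>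

lemma solves_current_conserved:
  assumes uv: "solves c d q u v" and real: "\<And>x. q x \<in> \<real>" and x: "x \<in> {c..d}"
  shows "Im (cnj (u x) * v x) = Im (cnj (u c) * v c)"
proof -
  have "primitive c d u v" and v: "primitive c d v (\<lambda>x. q x * u x)"
    using uv by (auto simp: solves_def)
  from primitive_mult[OF primitive_cnj[OF this(1)] this(2)]
  have "((\<lambda>t. cnj (v t) * v t + cnj (u t) * (q t * u t)) has_integral
      (cnj (u x) * v x - cnj (u c) * v c)) {c..x}"
    using x by (intro primitive_has_integral[of c d "\<lambda>x. cnj (u x) * v x"]) auto
  from has_integral_linear[OF this bounded_linear_Im]
  have "((\<lambda>t. Im (cnj (v t) * v t + cnj (u t) * (q t * u t))) has_integral
      Im (cnj (u x) * v x - cnj (u c) * v c)) {c..x}" by (simp add: o_def)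
  moreover have "Im (cnj (v t) * v t + cnj (u t) * (q t * u t)) = 0" for t
    using real[of t] by (auto elim!: Reals_cases simp: algebra_simps)
  ultimately have "((\<lambda>t. 0) has_integral Im (cnj (u x) * v x - cnj (u c) * v c)) {c..x}" by simp
  then have "Im (cnj (u x) * v x - cnj (u c) * v c) = 0" using has_integral_unique has_integral_0 by blast
  then show ?thesis by simp
qed

section \<open>From the weak equation to the integral form\<close>

lemma deriv_on_primitive:
  assumes "primitive c d u v" and "continuous_on {c..d} v" and "c < d" and "x \<in> {c..d}"
  shows "deriv_on c d u x = v x"
  unfolding deriv_on_def
  by (rule vector_derivative_within_closed_interval[OF _ _ primitive_has_vector_derivative[OF assms(1,2,4)]])
     (use assms(3,4) in auto)

lemma W2_inf_primitive:
  assumes "u \<in> W2_inf c d"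
  shows "primitive c d u (deriv_on c d u)"
proof (rule primitive_of_vector_derivative)
  show "(u has_vector_derivative deriv_on c d u x) (at x within {c..d})" if "x \<in> {c..d}" for x
    using assms that by (simp add: W2_inf_def deriv_on_def vector_derivative_works)
  show "continuous_on {c..d} (deriv_on c d u)" using assms by (simp add: W2_inf_def)
qed

definition coeff :: "real \<Rightarrow> (real \<Rightarrow> real) \<Rightarrow> real \<Rightarrow> complex" where
  "coeff \<epsilon> a x = of_real (- (a x / \<epsilon>^2))"

lemma coeff_L_inf:
  assumes "a \<in> L_inf c d"
  shows "coeff \<epsilon> a \<in> L_inf c d"
  using L_inf_cmult[OF L_inf_of_real[OF assms], of "- 1 / of_real (\<epsilon>^2)"]
  by (simp add: coeff_def[abs_def])

lemma schroedinger_imp_solves: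
  assumes u: "u \<in> W2_inf c d" and eq: "schroedinger \<epsilon> a c d u"
    and a: "a \<in> L_inf c d" and "c < d" and "0 < \<epsilon>"
  shows "solves c d (coeff \<epsilon> a) u (deriv_on c d u)"
proof -
  note pu = W2_inf_primitive[OF u]
  have cont: "continuous_on {c..d} (deriv_on c d u)" using u by (simp add: W2_inf_def)
  obtain w where w: "w \<in> L_inf c d" "weak_deriv 2 c d u w"
    "AE x in lebesgue_on {c<..<d}. complex_of_real (\<epsilon>^2) * w x + complex_of_real (a x) * u x = 0"
    using eq by (auto simp: schroedinger_def)
  have "primitive c d (deriv_on c d u) w"
    using weak_deriv_2_iff_primitive[OF pu cont w(1) \<open>c < d\<close>] w(2) by simp
  moreover have "(\<lambda>x. coeff \<epsilon> a x * u x) \<in> L_inf c d"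
    by (rule L_inf_mult[OF coeff_L_inf[OF a] primitive_L_inf(1)[OF pu]])
  moreover have "AE x in lebesgue_on {c<..<d}. coeff \<epsilon> a x * u x = w x"
    using w(3)
  proof eventually_elim
    case (elim x)
    then have "complex_of_real (\<epsilon>^2) * w x = - (complex_of_real (a x) * u x)"
      by (simp add: eq_neg_iff_add_eq_0)
    then show ?case using \<open>0 < \<epsilon>\<close> by (simp add: coeff_def field_simps)
  qed
  ultimately have "primitive c d (deriv_on c d u) (\<lambda>x. coeff \<epsilon> a x * u x)"
    by (rule primitive_cong_AE)
  with pu show ?thesis by (simp add: solves_def)
qed

lemma solves_imp_schroedinger:
  assumes uv: "solves c d (coeff \<epsilon> a) u v" and "c < d" and "0 < \<epsilon>"
  shows "u \<in> W2_inf c d" and "schroedinger \<epsilon> a c d u"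
    and "\<And>x. x \<in> {c..d} \<Longrightarrow> deriv_on c d u x = v x"
proof -
  let ?w = "\<lambda>x. coeff \<epsilon> a x * u x"
  have u: "primitive c d u v" and v: "primitive c d v ?w" using uv by (auto simp: solves_def)
  note cont = primitive_continuous_on[OF v]
  show deriv: "deriv_on c d u x = v x" if "x \<in> {c..d}" for x
    by (rule deriv_on_primitive[OF u cont \<open>c < d\<close> that])
  have w: "?w \<in> L_inf c d" by (rule primitive_L_inf(2)[OF v])
  have wd: "weak_deriv 2 c d u ?w" using weak_deriv_2_iff_primitive[OF u cont w \<open>c < d\<close>] v by simp
  show "u \<in> W2_inf c d"
    unfolding W2_inf_def mem_Collect_eq
  proof (intro conjI ballI)
    show "u differentiable (at x within {c..d})" if "x \<in> {c..d}" for x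
      using primitive_has_vector_derivative[OF u cont that] differentiableI_vector by blast
    show "continuous_on {c..d} (deriv_on c d u)"
      using cont by (rule continuous_on_eq) (simp add: deriv)
    show "u \<in> L_inf c d" by (rule primitive_L_inf(1)[OF u])
    fix k :: nat assume "k \<in> {1, 2}"
    then show "\<exists>w\<in>L_inf c d. weak_deriv k c d u w"
      using weak_deriv_1_if_primitive[OF u] \<open>c < d\<close> primitive_L_inf(2)[OF u] wd w by auto
  qed
  have "complex_of_real (\<epsilon>^2) * ?w x + complex_of_real (a x) * u x = 0" for x
    using \<open>0 < \<epsilon>\<close> by (simp add: coeff_def)
  with w wd show "schroedinger \<epsilon> a c d u" unfolding schroedinger_def by (intro bexI[of _ ?w]) auto
qed

section \<open>The algorithm in terms of one global solution\<close>

text \<open>The global solution \<open>Z\<close> with derivative \<open>V\<close> that carries the whole argument; its data at \<open>0\<close>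
  are those of Step 1.\<close>

locale outgoing_solution =
  fixes \<epsilon> a0 a1 :: real and a :: "real \<Rightarrow> real" and Z V :: "real \<Rightarrow> complex"
  assumes a: "a \<in> L_inf 0 1" and pos: "0 < \<epsilon>" "0 < a0" "0 < a1"
    and Z_solves: "solves 0 1 (coeff \<epsilon> a) Z V"
    and Z_0: "Z 0 = 1" and V_0: "\<epsilon> * V 0 = - \<i> * sqrt a0"
begin

definition multiple_on :: "real \<Rightarrow> real \<Rightarrow> complex \<Rightarrow> (real \<Rightarrow> complex) \<Rightarrow> bool" where
  "multiple_on c d k u \<longleftrightarrow> (\<forall>x\<in>{c..d}. u x = k * Z x)"

lemma multiple_on_solves:
  assumes "multiple_on c d k u" and "0 \<le> c" "d \<le> 1"
  shows "solves c d (coeff \<epsilon> a) u (\<lambda>x. k * V x)"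
proof -
  have kZ: "solves c d (coeff \<epsilon> a) (\<lambda>x. k * Z x) (\<lambda>x. k * V x)"
    by (intro solves_cmult solves_subset[OF Z_solves] assms)
  then have u: "primitive c d u (\<lambda>x. k * V x)"
    using assms(1) by (auto simp: solves_def multiple_on_def intro: primitive_cong)
  have "primitive c d (\<lambda>x. k * V x) (\<lambda>x. coeff \<epsilon> a x * u x)"
    unfolding primitive_def
  proof (intro conjI ballI)
    show "(\<lambda>x. coeff \<epsilon> a x * u x) \<in> L_inf c d"
      by (rule L_inf_mult[OF L_inf_subset[OF coeff_L_inf[OF a]] primitive_L_inf(1)[OF u]]) (use assms in auto)
    fix x assume x: "x \<in> {c..d}"
    with kZ have "((\<lambda>x. coeff \<epsilon> a x * (k * Z x)) has_integral (k * V x - k * V c)) {c..x}"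
      by (simp add: solves_def primitive_def)
    then show "((\<lambda>x. coeff \<epsilon> a x * u x) has_integral (k * V x - k * V c)) {c..x}"
      by (rule has_integral_eq[rotated]) (use assms(1) x in \<open>auto simp: multiple_on_def\<close>)
  qed
  with u show ?thesis by (simp add: solves_def)
qed

lemmas multiple_on_schroedinger = solves_imp_schroedinger[OF multiple_on_solves _ pos(1)]

lemma multiple_on_if_initial_data:
  assumes u: "u \<in> W2_inf c d" "schroedinger \<epsilon> a c d u" and cd: "0 \<le> c" "c < d" "d \<le> 1"
    and init: "u c = k * Z c" "deriv_on c d u c = k * V c"
  shows "multiple_on c d k u"
  unfolding multiple_on_def
proof
  fix x assume x: "x \<in> {c..d}"
  have a': "a \<in> L_inf c d" by (rule L_inf_subset[OF a]) (use cd in auto)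
  show "u x = k * Z x"
    using solves_unique[OF schroedinger_imp_solves[OF u a' cd(2) pos(1)]
        solves_cmult[OF solves_subset[OF Z_solves cd(1,3)], of k] coeff_L_inf[OF a'] init x] .
qed

text \<open>The common pattern of all boundary value problems below: side conditions \<open>Q\<close> that single out
  one multiple of \<open>Z\<close>.\<close>

lemma unique_in_W2_inf_iff_multiple_on:
  assumes cd: "0 \<le> c" "c < d" "d \<le> 1"
    and suff: "\<And>u. multiple_on c d k u \<Longrightarrow> Q u"
    and nec: "\<And>u. \<lbrakk>u \<in> W2_inf c d; schroedinger \<epsilon> a c d u; Q u\<rbrakk> \<Longrightarrow> multiple_on c d k u"
  shows "unique_in_W2_inf c d (\<lambda>u. schroedinger \<epsilon> a c d u \<and> Q u) u \<longleftrightarrow> multiple_on c d k u"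
proof
  assume "unique_in_W2_inf c d (\<lambda>u. schroedinger \<epsilon> a c d u \<and> Q u) u"
  then show "multiple_on c d k u" by (auto simp: unique_in_W2_inf_def intro: nec)
next
  assume u: "multiple_on c d k u"
  have "v x = u x" if "v \<in> W2_inf c d" "schroedinger \<epsilon> a c d v" "Q v" "x \<in> {c..d}" for v x
    using u nec[OF that(1-3)] that(4) by (simp add: multiple_on_def)
  then show "unique_in_W2_inf c d (\<lambda>u. schroedinger \<epsilon> a c d u \<and> Q u) u"
    using multiple_on_schroedinger(1,2)[OF u cd(1,3,2)] suff[OF u]
    by (auto simp: unique_in_W2_inf_def)
qed

text \<open>At \<open>0\<close> the current is \<open>- \<surd>a0 / \<epsilon>\<close>, and it is conserved.\<close>

lemma current:
  assumes "x \<in> {0..1}"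
  shows "Im (cnj (Z x) * V x) < 0"
proof -
  have "V 0 = - \<i> * (sqrt a0 / \<epsilon>)" using V_0 pos by (simp add: field_simps)
  then have "Im (cnj (Z 0) * V 0) = - (sqrt a0 / \<epsilon>)" by (simp add: Z_0)
  moreover have "Im (cnj (Z x) * V x) = Im (cnj (Z 0) * V 0)"
    by (rule solves_current_conserved[OF Z_solves _ assms]) (simp add: coeff_def)
  ultimately show ?thesis using pos by simp
qed

lemma Z_nonzero: "x \<in> {0..1} \<Longrightarrow> Z x \<noteq> 0"
  and V_nonzero: "x \<in> {0..1} \<Longrightarrow> V x \<noteq> 0"
  using current[of x] by auto

definition outflow :: complex where
  "outflow = \<epsilon> * V 1 - \<i> * sqrt a1 * Z 1"

text \<open>Otherwise \<open>V 1\<close> would be \<open>\<i> \<surd>a1 / \<epsilon>\<close> times \<open>Z 1\<close>, and the current at \<open>1\<close> would be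
  nonnegative.\<close>

lemma outflow_nonzero: "outflow \<noteq> 0"
proof
  assume "outflow = 0"
  then have "V 1 = \<i> * (sqrt a1 / \<epsilon>) * Z 1" using pos by (simp add: outflow_def field_simps)
  then have "cnj (Z 1) * V 1 = \<i> * (sqrt a1 / \<epsilon>) * (Z 1 * cnj (Z 1))" by simp
  also have "\<dots> = \<i> * of_real (sqrt a1 / \<epsilon> * (cmod (Z 1))^2)"
    by (simp only: complex_norm_square of_real_mult mult.assoc)
  finally have "Im (cnj (Z 1) * V 1) = sqrt a1 / \<epsilon> * (cmod (Z 1))^2" by simp
  also have "\<dots> \<ge> 0" using pos by simp
  finally show False using current[of 1] by simp
qed

text \<open>The factor for which \<open>\<kappa> Z\<close> satisfies the inhomogeneous condition at \<open>1\<close>.\<close>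

definition \<kappa> :: complex where
  "\<kappa> = - 2 * \<i> * sqrt a1 / outflow"

lemma \<kappa>_nonzero: "\<kappa> \<noteq> 0"
  using pos outflow_nonzero by (simp add: \<kappa>_def)

lemma bvp_iff:
  "unique_in_W2_inf 0 1 (schroedinger_bvp \<epsilon> a a0 a1) u \<longleftrightarrow> multiple_on 0 1 \<kappa> u"
proof -
  have "unique_in_W2_inf 0 1 (\<lambda>u. schroedinger \<epsilon> a 0 1 u \<and>
     (complex_of_real \<epsilon> * deriv_on 0 1 u 0 + \<i> * complex_of_real (sqrt a0) * u 0 = 0 \<and>
     complex_of_real \<epsilon> * deriv_on 0 1 u 1 - \<i> * complex_of_real (sqrt a1) * u 1
       = - 2 * \<i> * complex_of_real (sqrt a1))) u \<longleftrightarrow> multiple_on 0 1 \<kappa> u"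
  proof (rule unique_in_W2_inf_iff_multiple_on)
    have right: "\<epsilon> * deriv_on 0 1 u 1 - \<i> * sqrt a1 * u 1 = k * outflow" if "multiple_on 0 1 k u" for k u
      using multiple_on_schroedinger(3)[OF that, of 1] that
      by (simp add: multiple_on_def outflow_def algebra_simps)
    have left: "\<epsilon> * deriv_on 0 1 u 0 + \<i> * sqrt a0 * u 0 = 0" if "multiple_on 0 1 k u" for k u
    proof -
      have "\<epsilon> * deriv_on 0 1 u 0 = k * (\<epsilon> * V 0)" "u 0 = k"
        using multiple_on_schroedinger(3)[OF that, of 0] that by (simp_all add: multiple_on_def Z_0)
      then show ?thesis by (simp add: V_0)
    qed
    show "\<epsilon> * deriv_on 0 1 u 0 + \<i> * sqrt a0 * u 0 = 0 \<and>
        \<epsilon> * deriv_on 0 1 u 1 - \<i> * sqrt a1 * u 1 = - 2 * \<i> * sqrt a1" if "multiple_on 0 1 \<kappa> u" for u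
      using left[OF that] right[OF that] outflow_nonzero by (simp add: \<kappa>_def)
    fix u assume u: "u \<in> W2_inf 0 1" "schroedinger \<epsilon> a 0 1 u"
      and bc: "\<epsilon> * deriv_on 0 1 u 0 + \<i> * sqrt a0 * u 0 = 0 \<and>
        \<epsilon> * deriv_on 0 1 u 1 - \<i> * sqrt a1 * u 1 = - 2 * \<i> * sqrt a1"
    have "\<epsilon> * deriv_on 0 1 u 0 = u 0 * (\<epsilon> * V 0)"
      using bc by (simp add: V_0 add_eq_0_iff2)
    then have "deriv_on 0 1 u 0 = u 0 * V 0" using pos by simp
    then have m: "multiple_on 0 1 (u 0) u"
      by (intro multiple_on_if_initial_data u) (auto simp: Z_0)
    then have "u 0 = \<kappa>" using right[OF m] bc outflow_nonzero by (simp add: \<kappa>_def field_simps)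
    with m show "multiple_on 0 1 \<kappa> u" by simp
  qed auto
  then show ?thesis by (simp add: schroedinger_bvp_def[abs_def])
qed

lemma step1_iff:
  assumes "0 < xc" "xc < 1"
  shows "step1 \<epsilon> a a0 xc \<zeta> \<longleftrightarrow> multiple_on 0 xc 1 \<zeta>"
  unfolding step1_def
proof (rule unique_in_W2_inf_iff_multiple_on)
  show "z 0 = 1 \<and> \<epsilon> * deriv_on 0 xc z 0 = - \<i> * sqrt a0" if "multiple_on 0 xc 1 z" for z
    using multiple_on_schroedinger(3)[OF that, of 0] that assms
    by (simp add: multiple_on_def Z_0 V_0)
  show "multiple_on 0 xc 1 z" if "z \<in> W2_inf 0 xc" "schroedinger \<epsilon> a 0 xc z"
    "z 0 = 1 \<and> \<epsilon> * deriv_on 0 xc z 0 = - \<i> * sqrt a0" for z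
  proof -
    have "\<epsilon> * deriv_on 0 xc z 0 = \<epsilon> * V 0" using that(3) by (simp only: V_0)
    then have "deriv_on 0 xc z 0 = V 0" using pos by simp
    then show ?thesis using that assms by (intro multiple_on_if_initial_data) (auto simp: Z_0)
  qed
qed (use assms in auto)

text \<open>The factor for which \<open>\<mu> xd * Z\<close> satisfies the normalisation \<open>\<epsilon> \<chi>'(xd) = 1\<close> of Step 2.\<close>

definition \<mu> :: "real \<Rightarrow> complex" where
  "\<mu> xd = 1 / (\<epsilon> * V xd)"

text \<open>The condition at \<open>xc\<close> says that the data of \<open>\<chi>\<close> there are proportional to those of \<open>Z\<close>; as
  \<open>Z xc\<close> is nonzero, \<open>\<chi>\<close> is a multiple of \<open>Z\<close>. The condition at \<open>xd\<close> then fixes the factor,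
  because \<open>V xd\<close> is nonzero.\<close>

lemma step2_iff:
  assumes "0 < xc" "xc < xd" "xd < 1" and \<zeta>: "multiple_on 0 xc 1 \<zeta>"
  shows "step2 \<epsilon> a xc xd \<zeta> chi \<longleftrightarrow> multiple_on xc xd (\<mu> xd) chi"
proof -
  have \<zeta>': "deriv_on 0 xc \<zeta> xc = V xc" "\<zeta> xc = Z xc"
    using multiple_on_schroedinger(3)[OF \<zeta>, of xc] \<zeta> assms by (auto simp: multiple_on_def)
  have Zc: "Z xc \<noteq> 0" and Vd: "V xd \<noteq> 0" using assms Z_nonzero V_nonzero by auto
  show ?thesis
    unfolding step2_def \<zeta>'
  proof (rule unique_in_W2_inf_iff_multiple_on)
    have right: "deriv_on xc xd z xd = k * V xd" if "multiple_on xc xd k z" for k z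
      using multiple_on_schroedinger(3)[OF that, of xd] assms by simp
    show "V xc * z xc - Z xc * deriv_on xc xd z xc = 0 \<and> \<epsilon> * deriv_on xc xd z xd = 1"
      if "multiple_on xc xd (\<mu> xd) z" for z
      using multiple_on_schroedinger(3)[OF that, of xc] right[OF that] that assms pos Vd
      by (simp add: multiple_on_def \<mu>_def)
    fix z assume z: "z \<in> W2_inf xc xd" "schroedinger \<epsilon> a xc xd z"
      and bc: "V xc * z xc - Z xc * deriv_on xc xd z xc = 0 \<and> \<epsilon> * deriv_on xc xd z xd = 1"
    have m: "multiple_on xc xd (z xc / Z xc) z"
      using z bc assms Zc by (intro multiple_on_if_initial_data) (auto simp: field_simps)
    then have "z xc / Z xc = \<mu> xd"
      using right[OF m] bc Vd pos by (simp add: \<mu>_def field_simps)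
    with m show "multiple_on xc xd (\<mu> xd) z" by simp
  qed (use assms in auto)
qed

lemma step3_iff:
  assumes "0 < xc" "xc < xd" "xd < 1" and chi: "multiple_on xc xd k chi"
  shows "step3 \<epsilon> a xc xd chi \<phi> \<longleftrightarrow> multiple_on xd 1 k \<phi>"
proof -
  have chi': "deriv_on xc xd chi xd = k * V xd" "chi xd = k * Z xd"
    using multiple_on_schroedinger(3)[OF chi, of xd] chi assms by (auto simp: multiple_on_def)
  show ?thesis
    unfolding step3_def chi'
  proof (rule unique_in_W2_inf_iff_multiple_on)
    show "z xd = k * Z xd \<and> deriv_on xd 1 z xd = k * V xd" if "multiple_on xd 1 k z" for z
      using multiple_on_schroedinger(3)[OF that, of xd] that assms by (simp add: multiple_on_def)
    show "multiple_on xd 1 k z" if "z \<in> W2_inf xd 1" "schroedinger \<epsilon> a xd 1 z"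
      "z xd = k * Z xd \<and> deriv_on xd 1 z xd = k * V xd" for z
      using that assms by (intro multiple_on_if_initial_data) auto
  qed (use assms in auto)
qed

text \<open>The scaling equations undo the arbitrary normalisation of Step 2: on every piece the scaled
  function is \<open>\<kappa> Z\<close>.\<close>

lemma step4_iff:
  assumes "0 < xc" "xc < xd" "xd < 1" and m: "multiple_on 0 xc 1 \<zeta>" "multiple_on xc xd k chi"
    "multiple_on xd 1 k \<phi>" and "k \<noteq> 0"
  shows "step4 \<epsilon> a1 xc xd \<zeta> chi \<phi> \<alpha> \<beta> \<longleftrightarrow> \<alpha> = \<kappa> / k \<and> \<beta> = \<kappa>"
proof -
  have vals: "\<zeta> xc = Z xc" "chi xc = k * Z xc" "\<phi> 1 = k * Z 1"
    using m assms by (auto simp: multiple_on_def)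
  have "deriv_on xd 1 \<phi> 1 = k * V 1" using multiple_on_schroedinger(3)[OF m(3), of 1] assms by simp
  then have "\<epsilon> * deriv_on xd 1 \<phi> 1 - \<i> * sqrt a1 * \<phi> 1 = k * outflow"
    by (simp add: vals outflow_def algebra_simps)
  moreover have "Z xc \<noteq> 0" using assms by (intro Z_nonzero) auto
  ultimately have "scaling_eqs \<epsilon> a1 xc xd \<zeta> chi \<phi> \<alpha> \<beta> \<longleftrightarrow>
      \<alpha> * k * outflow = \<kappa> * outflow \<and> \<beta> * Z xc = \<alpha> * k * Z xc" for \<alpha> \<beta>
    using outflow_nonzero by (simp add: scaling_eqs_def vals \<kappa>_def mult.assoc)
  then have "scaling_eqs \<epsilon> a1 xc xd \<zeta> chi \<phi> \<alpha> \<beta> \<longleftrightarrow> \<alpha> = \<kappa> / k \<and> \<beta> = \<kappa>" for \<alpha> \<beta>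
    using outflow_nonzero \<open>Z xc \<noteq> 0\<close> \<open>k \<noteq> 0\<close> by (auto simp: nonzero_eq_divide_eq)
  then show ?thesis using \<kappa>_nonzero \<open>k \<noteq> 0\<close> by (auto simp: step4_def)
qed

lemma three_region_output_multiple_on:
  assumes "0 < xc" "xc < xd" "xd < 1"
  shows "\<exists>\<psi>. three_region_output \<epsilon> a a0 a1 xc xd \<psi>"
    and "three_region_output \<epsilon> a a0 a1 xc xd \<psi> \<Longrightarrow> multiple_on 0 1 \<kappa> \<psi>"
proof -
  have \<mu>: "\<mu> xd \<noteq> 0" using assms V_nonzero[of xd] pos by (simp add: \<mu>_def)
  let ?u = "\<lambda>x. \<mu> xd * Z x"
  have "multiple_on 0 xc 1 Z" "multiple_on xc xd (\<mu> xd) ?u" "multiple_on xd 1 (\<mu> xd) ?u"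
    by (auto simp: multiple_on_def)
  then have "step1 \<epsilon> a a0 xc Z" "step2 \<epsilon> a xc xd Z ?u" "step3 \<epsilon> a xc xd ?u ?u"
    "step4 \<epsilon> a1 xc xd Z ?u ?u (\<kappa> / \<mu> xd) \<kappa>"
    using assms \<mu> by (auto simp: step1_iff step2_iff step3_iff step4_iff)
  then show "\<exists>\<psi>. three_region_output \<epsilon> a a0 a1 xc xd \<psi>"
    unfolding three_region_output_def by blast
  assume "three_region_output \<epsilon> a a0 a1 xc xd \<psi>"
  then obtain \<zeta> chi \<phi> \<alpha> \<beta> where s: "step1 \<epsilon> a a0 xc \<zeta>" "step2 \<epsilon> a xc xd \<zeta> chi"
    "step3 \<epsilon> a xc xd chi \<phi>" "step4 \<epsilon> a1 xc xd \<zeta> chi \<phi> \<alpha> \<beta>"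
    and \<psi>: "\<psi> = (\<lambda>x. if x \<le> xc then \<beta> * \<zeta> x else if x \<le> xd then \<alpha> * chi x else \<alpha> * \<phi> x)"
    unfolding three_region_output_def by blast
  have \<zeta>: "multiple_on 0 xc 1 \<zeta>" using s(1) step1_iff assms by simp
  have chi: "multiple_on xc xd (\<mu> xd) chi" using s(2) step2_iff[OF assms \<zeta>] by simp
  have \<phi>: "multiple_on xd 1 (\<mu> xd) \<phi>" using s(3) step3_iff[OF assms chi] by simp
  have "\<alpha> = \<kappa> / \<mu> xd" "\<beta> = \<kappa>" using s(4) step4_iff[OF assms \<zeta> chi \<phi> \<mu>] by auto
  with \<zeta> chi \<phi> \<mu> show "multiple_on 0 1 \<kappa> \<psi>" by (auto simp: multiple_on_def \<psi>)
qed

end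

theorem proposition6:
  fixes a :: "real \<Rightarrow> real" and a0 a1 \<epsilon> xc xd :: real
  assumes "0 < xc" and "xc < xd" and "xd < 1"
    and "a \<in> L_inf 0 1"
    and "AE x in lebesgue_on {xc<..<xd}. a x < 0"
    and "AE x in lebesgue_on ({0<..<xc} \<union> {xd<..<1}). a x > 0"
    and "a0 > 0" and "a1 > 0" and "\<epsilon> > 0"
  shows "(\<exists>\<psi>. three_region_output \<epsilon> a a0 a1 xc xd \<psi>) \<and>
    (\<forall>\<psi>. three_region_output \<epsilon> a a0 a1 xc xd \<psi> \<longrightarrow>
       \<psi> \<in> W2_inf 0 1 \<and> schroedinger_bvp \<epsilon> a a0 a1 \<psi> \<and>
       (\<forall>u\<in>W2_inf 0 1. schroedinger_bvp \<epsilon> a a0 a1 u \<longrightarrow> (\<forall>x\<in>{0..1}. u x = \<psi> x)))"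
proof -
  obtain Z V where "solves 0 1 (coeff \<epsilon> a) Z V" "Z 0 = 1" "V 0 = - \<i> * sqrt a0 / \<epsilon>"
    using solves_exists[OF coeff_L_inf[OF assms(4), of \<epsilon>]] by (metis zero_le_one)
  then interpret outgoing_solution \<epsilon> a0 a1 a Z V
    using assms by unfold_locales auto
  show ?thesis
    using three_region_output_multiple_on[OF assms(1-3)] bvp_iff
    unfolding unique_in_W2_inf_def by blast
qed

end
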